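(* Let $\ell>0$ and let $f\in W^{1,2}(0,\ell)$ be complex-valued with $f(x)\neq0$ for all $x\in[0,\ell]$ and $f(0)=1$. Let $\mathbf{T}_f$ be the transmutation operator and $\{\varphi_f^{(k)}\}_{k=0}^\infty$ the formal powers associated with $f$. Then $$\mathbf{T}_f[x^k]=\varphi_f^{(k)}(x)\qquad\forall k\in\mathbb{N}_0=\{0,1,2,\dots\}.$$
   Context: All functions are complex-valued. $\mathcal{T}_\ell=\{(x,t): 0\le x\le\ell,\ |t|\le x\}$. $\mathbf{D}_f y:=f(y/f)'=y'-\frac{f'}{f}y$, $\mathbf{D}_{\frac1f}y:=\frac1f(fy)'=y'+\frac{f'}{f}y$. $\mathbf{S}_f$ is the Schrödinger operator $-y''+q_fy$ on $(0,\ell)$ with distributional potential $q_f=f''/f\in W^{-1,2}(0,\ell)$; its domain is $\mathscr{D}_2(\mathbf{S}_f)=\{y\in W^{1,2}(0,\ell):\mathbf{D}_fy\in W^{1,2}(0,\ell)\}$ and there $\mathbf{S}_fy=-\mathbf{D}_{\frac1f}\mathbf{D}_fy\in L^2(0,\ell)$. For $\rho\in\mathbb{C}$, $e_f(\rho,\cdot)\in\mathscr{D}_2(\mathbf{S}_f)$ is the unique solution of $\mathbf{S}_fy=\rho^2y$ with $y(0)=1$, $\mathbf{D}_fy(0)=i\rho$. $K_f\in L^2(\mathcal{T}_\ell)$ is the kernel with $K_f(x,\cdot)\in L^2(-x,x)$ and $e_f(\rho,x)=e^{i\rho x}+\int_{-x}^xK_f(x,t)e^{i\rho t}dt$ for all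 $\rho\in\mathbb{C}$, $x\in(0,\ell]$ (such a kernel exists and is unique up to null sets). The operator $\mathbf{T}_f:L^2(-\ell,\ell)\to L^2(0,\ell)$ is $\mathbf{T}_fy(x)=y(x)+\int_{-x}^xK_f(x,t)y(t)\,dt$. The formal powers are $\varphi_f^{(0)}=f$, $\varphi_f^{(1)}(x)=f(x)\int_0^x\frac{dt}{f^2(t)}$, and for $k\ge2$, $\varphi_f^{(k)}(x)=k(k-1)f(x)\int_0^x\frac1{f^2(t)}\left[\int_0^tf(s)\varphi_f^{(k-2)}(s)ds\right]dt$. *)

theory Defs
  imports "HOL-Analysis.Analysis"
begin

definition L2_on :: "'a::euclidean_space set \<Rightarrow> ('a \<Rightarrow> complex) \<Rightarrow> bool" where
  "L2_on A y \<longleftrightarrow> y \<in> borel_measurable (lebesgue_on A) \<and>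
     integrable (lebesgue_on A) (\<lambda>x. (cmod (y x))\<^sup>2)"

text \<open>
  Test functions are the compactly supported \<open>C\<^sup>1\<close> functions on \<open>(0,l)\<close>, as in Brezis' definition
  of \<open>W\<^sup>1\<^sup>,\<^sup>2\<close> on an interval; smooth test functions give the same space and the same weak derivatives.
\<close>

definition test_functions :: "real \<Rightarrow> (real \<Rightarrow> complex) set" where
  "test_functions l = {\<phi>. \<phi> C1_differentiable_on UNIV \<and>
     (\<exists>C. compact C \<and> C \<subseteq> {0<..<l} \<and> (\<forall>x. x \<notin> C \<longrightarrow> \<phi> x = 0))}"

definition has_weak_deriv :: "real \<Rightarrow> (real \<Rightarrow> complex) \<Rightarrow> (real \<Rightarrow> complex) \<Rightarrow> bool" where
  "has_weak_deriv l y g \<longleftrightarrow> L2_on {0<..<l} y \<and> L2_on {0<..<l} g \<and>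
     (\<forall>\<phi>\<in>test_functions l.
        (LINT x|lebesgue_on {0<..<l}. y x * vector_derivative \<phi> (at x)) =
        - (LINT x|lebesgue_on {0<..<l}. g x * \<phi> x))"

definition W12 :: "real \<Rightarrow> (real \<Rightarrow> complex) set" where
  "W12 l = {y. \<exists>g. has_weak_deriv l y g}"

text \<open>
  Elements of \<open>W12 l\<close> are arbitrary representatives of their almost-everywhere classes.
  \<open>weak_deriv l y\<close> is determined up to null sets. Point values on \<open>[0,l]\<close> are those of the
  continuous representative \<open>cont_rep l y\<close>, which is determined on \<open>[0,l]\<close>.
\<close>

definition weak_deriv :: "real \<Rightarrow> (real \<Rightarrow> complex) \<Rightarrow> real \<Rightarrow> complex" where
  "weak_deriv l y = (SOME g. has_weak_deriv l y g)"

definition cont_rep :: "real \<Rightarrow> (real \<Rightarrow> complex) \<Rightarrow> real \<Rightarrow> complex" where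
  "cont_rep l y = (SOME z. continuous_on {0..l} z \<and> (AE x in lebesgue_on {0<..<l}. z x = y x))"

definition Dop :: "real \<Rightarrow> (real \<Rightarrow> complex) \<Rightarrow> (real \<Rightarrow> complex) \<Rightarrow> real \<Rightarrow> complex" where
  "Dop l f y = (\<lambda>x. f x * weak_deriv l (\<lambda>s. y s / f s) x)"

definition Sdom :: "real \<Rightarrow> (real \<Rightarrow> complex) \<Rightarrow> (real \<Rightarrow> complex) set" where
  "Sdom l f = {y \<in> W12 l. Dop l f y \<in> W12 l}"

definition Sop :: "real \<Rightarrow> (real \<Rightarrow> complex) \<Rightarrow> (real \<Rightarrow> complex) \<Rightarrow> real \<Rightarrow> complex" where
  "Sop l f y = (\<lambda>x. - Dop l (\<lambda>s. 1 / f s) (Dop l f y) x)"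

text \<open>
  The solution is taken to be its continuous representative on \<open>[0,l]\<close>, extended by zero so that
  it is unique as a function on all reals.
\<close>

definition ef :: "real \<Rightarrow> (real \<Rightarrow> complex) \<Rightarrow> complex \<Rightarrow> real \<Rightarrow> complex" where
  "ef l f \<rho> = (THE y. continuous_on {0..l} y \<and> (\<forall>x. x \<notin> {0..l} \<longrightarrow> y x = 0) \<and>
     y \<in> Sdom l f \<and>
     (AE x in lebesgue_on {0<..<l}. Sop l f y x = \<rho>\<^sup>2 * y x) \<and>
     y 0 = 1 \<and> cont_rep l (Dop l f y) 0 = \<i> * \<rho>)"

definition triangle :: "real \<Rightarrow> (real \<times> real) set" where
  "triangle l = {(x, t). 0 \<le> x \<and> x \<le> l \<and> \<bar>t\<bar> \<le> x}"

definition transmutation_kernel ::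
    "real \<Rightarrow> (real \<Rightarrow> complex) \<Rightarrow> (real \<times> real \<Rightarrow> complex) \<Rightarrow> bool" where
  "transmutation_kernel l f K \<longleftrightarrow> L2_on (triangle l) K \<and>
     (\<forall>x\<in>{0<..l}. L2_on {-x<..<x} (\<lambda>t. K (x, t))) \<and>
     (\<forall>\<rho>. \<forall>x\<in>{0<..l}. ef l f \<rho> x = exp (\<i> * \<rho> * of_real x) +
        (LINT t|lebesgue_on {-x<..<x}. K (x, t) * exp (\<i> * \<rho> * of_real t)))"

definition Top :: "(real \<times> real \<Rightarrow> complex) \<Rightarrow> (real \<Rightarrow> complex) \<Rightarrow> real \<Rightarrow> complex" where
  "Top K y x = y x + (LINT t|lebesgue_on {-x<..<x}. K (x, t) * y t)"

fun formal_power :: "(real \<Rightarrow> complex) \<Rightarrow> nat \<Rightarrow> real \<Rightarrow> complex" where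
  "formal_power f 0 x = f x"
| "formal_power f (Suc 0) x = f x * (LINT t|lebesgue_on {0..x}. 1 / (f t)\<^sup>2)"
| "formal_power f (Suc (Suc k)) x =
     of_nat (Suc (Suc k)) * of_nat (Suc k) * f x *
     (LINT t|lebesgue_on {0..x}. 1 / (f t)\<^sup>2 * (LINT s|lebesgue_on {0..t}. f s * formal_power f k s))"

end

(*
  Writing y = f u and D_f y = w / f turns S_f y = rho^2 y into the first-order system u' = w / f^2,
  w' = - rho^2 f^2 u with continuous coefficients. Picard iteration solves it, and the iterates are
  the formal powers: e_f(rho, x) = sum over k of (i rho)^k / k! * phi_f^(k)(x). Expanding the
  exponentials in e_f(rho, x) = exp(i rho x) + integral of K_f(x, t) exp(i rho t) gives the power
  series in i rho with coefficients T_f[x^k] / k!. Comparing coefficients yields the theorem.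

  That the weak formulation determines e_f uniquely needs absolute continuity of W^{1,2} functions
  (du Bois-Reymond) and the product and reciprocal rules for them; the rules follow from the C^1 case
  by approximating the derivative in L^1 by continuous functions.
*)

theory Submission
  imports Defs
begin

text \<open>\<open>f\<close> need not have a classical derivative and the potential
  \<open>f''/f\<close> is a distribution, so the equation cannot be treated as a second-order one
  with a coefficient function. The quotients that \<open>Dop\<close> differentiates are
  \<open>y / f\<close> and \<open>Dop l f y / (1 / f)\<close>; with these as unknowns no derivative
  of \<open>f\<close> enters the equation, and only the weights 1/f^2 and f^2 remain. The same
  weights alternate in the formal powers, and the factors k(k-1) in their recursion build up k!.

  The obstacle is that \<open>ef\<close> is a definite description over functions whose weak
  derivatives and continuous representatives are themselves chosen by \<open>SOME\<close>. Nothing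
  can be said about \<open>ef\<close> before existence and uniqueness are known, and an identity for
  a chosen derivative holds only off a null set. The working notion is therefore
  \<open>primitive_on\<close>, an exact integral identity: null sets disappear once an equation is
  integrated.

  The kernel identity holds for each fixed \<open>x\<close>, so both expansions are compared as
  entire functions of the single variable z = \<open>\<i> * \<rho>\<close>.\<close>

section \<open>Null sets, absolute integrability and continuous approximation\<close>

lemma AE_lebesgue_on_iff_negligible:
  fixes S :: "'a::euclidean_space set"
  assumes "S \<in> sets lebesgue"
  shows "(AE x in lebesgue_on S. P x) \<longleftrightarrow> (\<exists>N. negligible N \<and> (\<forall>x\<in>S - N. P x))"
proof -
  have "(AE x in lebesgue_on S. P x) \<longleftrightarrow> (AE x in lebesgue. x \<in> S \<longrightarrow> P x)"
    using assms by (subst AE_restrict_space_iff) auto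
  then show ?thesis
    unfolding eventually_ae_filter_negligible by blast
qed

lemma abs_int_mult_continuous:
  fixes g a :: "real \<Rightarrow> complex"
  assumes "g absolutely_integrable_on {u..v}" "continuous_on {u..v} a"
  shows "(\<lambda>x. a x * g x) absolutely_integrable_on {u..v}"
proof (rule absolutely_integrable_bounded_measurable_product[OF bilinear_times _ _ _ assms(1)])
  show "a \<in> borel_measurable (lebesgue_on {u..v})"
    by (rule continuous_imp_measurable_on_sets_lebesgue[OF assms(2)]) simp
  show "bounded (a ` {u..v})"
    by (rule compact_imp_bounded[OF compact_continuous_image[OF assms(2) compact_Icc]])
qed simp

lemma norm_integral_le_integral_norm:
  fixes g :: "real \<Rightarrow> complex"
  assumes g: "g absolutely_integrable_on {0..l}" and x: "x \<in> {0..l}"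
  shows "norm (integral {0..x} g) \<le> integral {0..l} (\<lambda>t. norm (g t))"
proof -
  have gx: "g absolutely_integrable_on {0..x}"
    by (rule absolutely_integrable_on_subinterval[OF g]) (use x in auto)
  have "norm (integral {0..x} g) \<le> integral {0..x} (\<lambda>t. norm (g t))"
    using gx unfolding absolutely_integrable_on_def
    by (intro integral_norm_bound_integral) auto
  also have "\<dots> \<le> integral {0..l} (\<lambda>t. norm (g t))"
    using gx g x unfolding absolutely_integrable_on_def
    by (intro integral_subset_le) auto
  finally show ?thesis .
qed

text \<open>\<open>measurable_on\<close> by definition supplies an almost everywhere limit of
  continuous functions. Moving their values radially into the disc of radius \<open>B\<close> keeps
  continuity and gives a bound uniform in \<open>n\<close>; the limit already lies in that disc and
  is not changed.\<close>

lemma continuous_bounded_approximation: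
  fixes s :: "real \<Rightarrow> complex"
  assumes s: "s \<in> borel_measurable (lebesgue_on S)" and S: "S \<in> sets lebesgue"
    and B: "\<And>x. x \<in> S \<Longrightarrow> norm (s x) \<le> B" "0 < B"
  obtains c N where "\<And>n. continuous_on UNIV (c n)" "\<And>n x. norm (c n x :: complex) \<le> B"
    "negligible N" "\<And>x. x \<in> S - N \<Longrightarrow> (\<lambda>n. c n x) \<longlonglongrightarrow> s x"
proof -
  have "s measurable_on S"
    using s S by (simp add: measurable_on_iff_borel_measurable)
  then obtain N g where N: "negligible N" and g: "\<And>n. continuous_on UNIV (g n)"
    and lim: "\<And>x. x \<notin> N \<Longrightarrow> (\<lambda>n. g n x) \<longlonglongrightarrow> (if x \<in> S then s x else 0)"
    unfolding measurable_on_def by blast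
  define c where "c n x = of_real (B / max B (norm (g n x))) * g n x" for n x
  show thesis
  proof
    show "continuous_on UNIV (c n)" for n
      unfolding c_def using B(2) by (intro continuous_intros g) (auto simp: max_def split: if_splits)
    show "norm (c n x) \<le> B" for n x
    proof -
      have "norm (c n x) = B * (norm (g n x) / max B (norm (g n x)))"
        using B(2) by (simp add: c_def norm_mult norm_divide)
      also have "\<dots> \<le> B * 1"
        using B(2) by (intro mult_left_mono) (auto simp: divide_le_eq_1)
      finally show ?thesis by simp
    qed
    show "negligible N" by fact
    show "(\<lambda>n. c n x) \<longlonglongrightarrow> s x" if "x \<in> S - N" for x
    proof -
      have gs: "(\<lambda>n. g n x) \<longlonglongrightarrow> s x"
        using lim[of x] that by auto
      have "(\<lambda>n. c n x) \<longlonglongrightarrow> of_real (B / max B (norm (s x))) * s x"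
        unfolding c_def using B(2) by (intro tendsto_intros gs) auto
      moreover have "max B (norm (s x)) = B"
        using B(1)[of x] that by auto
      ultimately show ?thesis using B(2) by simp
    qed
  qed
qed

section \<open>Convergence in \<open>L\<^sup>1\<close>\<close>

text \<open>Integrability is part of the notion because \<open>integral\<close> returns 0 for a
  non-integrable integrand, which would make the limit clause meaningless on its own.\<close>

definition L1_lim :: "real \<Rightarrow> (nat \<Rightarrow> real \<Rightarrow> complex) \<Rightarrow> (real \<Rightarrow> complex) \<Rightarrow> bool" where
  "L1_lim l gn g \<longleftrightarrow> (\<forall>n. gn n absolutely_integrable_on {0..l}) \<and> g absolutely_integrable_on {0..l} \<and>
     (\<lambda>n. integral {0..l} (\<lambda>x. norm (gn n x - g x))) \<longlonglongrightarrow> 0"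

lemma L1_lim_dominated:
  assumes gn: "\<And>n. gn n absolutely_integrable_on {0..l}" and h: "h integrable_on {0..l}"
    and g: "g absolutely_integrable_on {0..l}"
    and bd: "\<And>n x. x \<in> {0..l} \<Longrightarrow> norm (gn n x - g x) \<le> h x"
    and N: "negligible N" and lim: "\<And>x. x \<in> {0..l} - N \<Longrightarrow> (\<lambda>n. gn n x) \<longlonglongrightarrow> g x"
  shows "L1_lim l gn g"
proof -
  \<comment> \<open>\<open>dominated_convergence\<close> asks for convergence at every point.
    Setting the integrand to 0 on \<open>N\<close> provides it without changing the
    integrals.\<close>
  let ?d = "\<lambda>n x. if x \<in> N then 0 else norm (gn n x - g x)"
  have ai: "(\<lambda>x. norm (gn n x - g x)) integrable_on {0..l}" for n
    using set_integral_diff(1)[OF gn g, of n] unfolding absolutely_integrable_on_def by blast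
  have eq: "integral {0..l} (\<lambda>x. norm (gn n x - g x)) = integral {0..l} (?d n)" for n
    by (rule integral_spike[OF N]) auto
  have "(\<lambda>n. integral {0..l} (?d n)) \<longlonglongrightarrow> integral {0..l} (\<lambda>x. 0)"
  proof (rule dominated_convergence(2)[OF _ h])
    show "?d n integrable_on {0..l}" for n
      by (rule integrable_spike[OF ai[of n] N]) auto
    show "norm (?d n x) \<le> h x" if "x \<in> {0..l}" for n x
      using bd[OF that, of n] norm_ge_zero[of "gn n x - g x"] by (auto simp del: norm_ge_zero)
    show "(\<lambda>n. ?d n x) \<longlonglongrightarrow> 0" if "x \<in> {0..l}" for x
    proof (cases "x \<in> N")
      case False
      then have "(\<lambda>n. norm (gn n x - g x)) \<longlonglongrightarrow> norm (g x - g x)"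
        using that by (intro tendsto_intros lim) auto
      then show ?thesis using False by simp
    qed auto
  qed
  then show ?thesis
    unfolding L1_lim_def using gn g eq by auto
qed

lemma L1_lim_integral:
  assumes "L1_lim l gn g" "x \<in> {0..l}"
  shows "(\<lambda>n. integral {0..x} (gn n)) \<longlonglongrightarrow> integral {0..x} g"
    and "norm (integral {0..x} (gn n) - integral {0..x} g) \<le> integral {0..l} (\<lambda>x. norm (gn n x - g x))"
proof -
  have gn: "gn n absolutely_integrable_on {0..l}" and g: "g absolutely_integrable_on {0..l}"
    and lim: "(\<lambda>n. integral {0..l} (\<lambda>x. norm (gn n x - g x))) \<longlonglongrightarrow> 0" for n
    using assms unfolding L1_lim_def by auto
  have bd: "norm (integral {0..x} (gn n) - integral {0..x} g) \<le> integral {0..l} (\<lambda>x. norm (gn n x - g x))" for n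
  proof -
    have "gn n integrable_on {0..x}" "g integrable_on {0..x}"
      using absolutely_integrable_on_subinterval[OF gn[of n], of 0 x]
        absolutely_integrable_on_subinterval[OF g, of 0 x] assms(2)
      by (auto simp: absolutely_integrable_on_def)
    then have "integral {0..x} (gn n) - integral {0..x} g = integral {0..x} (\<lambda>x. gn n x - g x)"
      by (simp add: Henstock_Kurzweil_Integration.integral_diff)
    then show ?thesis
      using norm_integral_le_integral_norm[OF set_integral_diff(1)[OF gn g, of n] assms(2)]
      by simp
  qed
  then show "norm (integral {0..x} (gn n) - integral {0..x} g) \<le> integral {0..l} (\<lambda>x. norm (gn n x - g x))" .
  show "(\<lambda>n. integral {0..x} (gn n)) \<longlonglongrightarrow> integral {0..x} g"
    by (rule Lim_transform[OF tendsto_const Lim_null_comparison[OF _ lim]])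
       (use bd in \<open>auto simp: norm_minus_commute\<close>)
qed

lemma L1_lim_exists:
  assumes g: "g absolutely_integrable_on {0..l}"
    and ex: "\<And>e. e > 0 \<Longrightarrow> \<exists>c. P c \<and> c absolutely_integrable_on {0..l} \<and>
            integral {0..l} (\<lambda>x. norm (c x - g x)) < e"
  shows "\<exists>gn. (\<forall>n. P (gn n)) \<and> L1_lim l gn g"
proof -
  have "\<forall>n. \<exists>c. P c \<and> c absolutely_integrable_on {0..l} \<and>
            integral {0..l} (\<lambda>x. norm (c x - g x)) < inverse (real (Suc n))"
    using ex by simp
  then obtain gn where gn: "\<And>n. P (gn n)" "\<And>n. gn n absolutely_integrable_on {0..l}"
    "\<And>n. integral {0..l} (\<lambda>x. norm (gn n x - g x)) < inverse (real (Suc n))" by metis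
  have "(\<lambda>n. integral {0..l} (\<lambda>x. norm (gn n x - g x))) \<longlonglongrightarrow> 0"
  proof (rule Lim_null_comparison[OF _ LIMSEQ_inverse_real_of_nat], intro always_eventually allI)
    fix n
    have "0 \<le> integral {0..l} (\<lambda>x. norm (gn n x - g x))"
      by (rule integral_nonneg) (use set_integral_diff(1)[OF gn(2) g, of n] in
          \<open>auto simp: absolutely_integrable_on_def\<close>)
    then show "norm (integral {0..l} (\<lambda>x. norm (gn n x - g x))) \<le> inverse (real (Suc n))"
      using gn(3)[of n] by simp
  qed
  then have "L1_lim l gn g" using gn(2) g by (simp add: L1_lim_def)
  then show ?thesis using gn(1) by blast
qed

text \<open>Two approximations, each with error \<open>e / 2\<close>: \<open>g\<close> is cut off at
  height \<open>n + 1\<close>, dominated by \<open>norm (g x)\<close>, and the bounded result is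
  then approximated by uniformly bounded continuous functions, dominated by a constant. Working with
  a fixed \<open>e\<close> avoids a diagonal sequence.\<close>

lemma L1_lim_continuous_exists:
  assumes g: "g absolutely_integrable_on {0..l}"
  shows "\<exists>gn. (\<forall>n. continuous_on UNIV (gn n)) \<and> L1_lim l gn g"
proof (rule L1_lim_exists[OF g, where P = "continuous_on UNIV"])
  fix e :: real assume e: "e > 0"
  define tr where "tr n x = of_real (real (Suc n) / max (real (Suc n)) (norm (g x))) * g x" for n x
  have gm: "g \<in> borel_measurable (lebesgue_on {0..l})"
    using g by (intro absolutely_integrable_imp_borel_measurable) auto
  have trm: "tr n \<in> borel_measurable (lebesgue_on {0..l})" for n
    unfolding tr_def using gm by measurable
  have gni: "(\<lambda>x. norm (g x)) integrable_on {0..l}"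
    using g by (auto simp: absolutely_integrable_on_def)
  have tr_form: "\<exists>c. 0 \<le> c \<and> c \<le> 1 \<and> tr n x = of_real c * g x" for n x
  proof (intro exI conjI)
    show "real (Suc n) / max (real (Suc n)) (norm (g x)) \<le> 1"
      by (simp add: divide_le_eq_1 max_def)
  qed (simp_all add: tr_def del: of_nat_Suc)
  have tr_le: "norm (tr n x) \<le> norm (g x)" "norm (tr n x - g x) \<le> norm (g x)" for n x
  proof -
    obtain c where c: "0 \<le> c" "c \<le> 1" "tr n x = of_real c * g x" using tr_form by blast
    have "tr n x - g x = of_real (c - 1) * g x" using c(3) by (simp add: algebra_simps)
    then show "norm (tr n x) \<le> norm (g x)" "norm (tr n x - g x) \<le> norm (g x)"
      using c by (auto simp: norm_mult mult_left_le_one_le simp flip: of_real_diff)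
  qed
  have tra: "tr n absolutely_integrable_on {0..l}" for n
    by (rule measurable_bounded_by_integrable_imp_absolutely_integrable[OF trm _ gni]) (auto intro: tr_le)
  have "L1_lim l tr g"
  proof (rule L1_lim_dominated[OF tra gni g tr_le(2) negligible_empty])
    fix x
    obtain N where N: "norm (g x) < real N" using reals_Archimedean2 by blast
    have "eventually (\<lambda>n. tr n x = g x) sequentially"
      using eventually_ge_at_top[of N]
    proof eventually_elim
      case (elim n)
      then have "max (real (Suc n)) (norm (g x)) = real (Suc n)" using N by auto
      then show ?case unfolding tr_def by (simp del: of_nat_Suc)
    qed
    then show "(\<lambda>n. tr n x) \<longlonglongrightarrow> g x" by (rule tendsto_eventually)
  qed
  then have "\<forall>\<^sub>F n in sequentially. integral {0..l} (\<lambda>x. norm (tr n x - g x)) < e/2"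
    unfolding L1_lim_def using order_tendstoD(2)[OF _ half_gt_zero[OF e]] by blast
  then obtain n where n: "integral {0..l} (\<lambda>x. norm (tr n x - g x)) < e/2"
    by (auto simp: eventually_sequentially)
  have trb: "norm (tr n x) \<le> real (Suc n)" for x
  proof -
    have "norm (tr n x) = real (Suc n) * (norm (g x) / max (real (Suc n)) (norm (g x)))"
      by (simp add: tr_def norm_mult norm_divide del: of_nat_Suc)
    also have "\<dots> \<le> real (Suc n) * 1"
      by (intro mult_left_mono) (auto simp: divide_le_eq_1 max_def)
    finally show ?thesis by simp
  qed
  obtain c N where c: "\<And>k. continuous_on UNIV (c k)" "\<And>k x. norm (c k x) \<le> real (Suc n)"
    "negligible N" "\<And>x. x \<in> {0..l} - N \<Longrightarrow> (\<lambda>k. c k x) \<longlonglongrightarrow> tr n x"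
    by (rule continuous_bounded_approximation[OF trm[of n] _ trb]) auto
  have ca: "c k absolutely_integrable_on {0..l}" for k
    by (rule absolutely_integrable_continuous_real) (rule continuous_on_subset[OF c(1)], simp)
  have "L1_lim l c (tr n)"
  proof (rule L1_lim_dominated[OF ca _ tra _ c(3,4)])
    show "(\<lambda>x. 2 * real (Suc n)) integrable_on {0..l}" by (rule integrable_const_ivl)
    show "norm (c k x - tr n x) \<le> 2 * real (Suc n)" for k x
      using c(2)[of k x] trb[of x] norm_triangle_ineq4[of "c k x" "tr n x"] by simp
  qed auto
  then have "\<forall>\<^sub>F k in sequentially. integral {0..l} (\<lambda>x. norm (c k x - tr n x)) < e/2"
    unfolding L1_lim_def using order_tendstoD(2)[OF _ half_gt_zero[OF e]] by blast
  then obtain k where k: "integral {0..l} (\<lambda>x. norm (c k x - tr n x)) < e/2"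
    by (auto simp: eventually_sequentially)
  have i1: "(\<lambda>x. norm (c k x - tr n x)) integrable_on {0..l}"
    and i2: "(\<lambda>x. norm (tr n x - g x)) integrable_on {0..l}"
    and i3: "(\<lambda>x. norm (c k x - g x)) integrable_on {0..l}"
    using set_integral_diff(1)[OF ca tra, of k n] set_integral_diff(1)[OF tra g, of n]
      set_integral_diff(1)[OF ca g, of k]
    unfolding absolutely_integrable_on_def by blast+
  have "integral {0..l} (\<lambda>x. norm (c k x - g x)) \<le>
        integral {0..l} (\<lambda>x. norm (c k x - tr n x) + norm (tr n x - g x))"
    by (intro integral_le i3 integrable_add i1 i2) (metis diff_add_cancel norm_triangle_ineq add_diff_eq)
  also have "\<dots> < e"
    using n k by (simp add: Henstock_Kurzweil_Integration.integral_add[OF i1 i2])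
  finally show "\<exists>c. continuous_on UNIV c \<and> c absolutely_integrable_on {0..l} \<and>
      integral {0..l} (\<lambda>x. norm (c x - g x)) < e"
    using c(1) ca by blast
qed

text \<open>In \<open>an * gn - a * g = an * (gn - g) + (an - a) * g\<close> the factor
  \<open>an\<close> is bounded by \<open>A + d\<close> as soon as it is within \<open>d\<close> of
  \<open>a\<close>, and the second term costs at most \<open>d\<close> times the L1 norm of
  \<open>g\<close>.\<close>

lemma L1_lim_mult:
  assumes a: "uniform_limit {0..l} an a sequentially" and an: "\<And>n. continuous_on {0..l} (an n)"
    and g: "L1_lim l gn g"
  shows "L1_lim l (\<lambda>n x. an n x * gn n x) (\<lambda>x. a x * g x)"
proof -
  have gn: "gn n absolutely_integrable_on {0..l}" and ga: "g absolutely_integrable_on {0..l}"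
    and lim: "(\<lambda>n. integral {0..l} (\<lambda>x. norm (gn n x - g x))) \<longlonglongrightarrow> 0" for n
    using g unfolding L1_lim_def by auto
  have ac: "continuous_on {0..l} a"
    using uniform_limit_theorem[OF _ a] an by auto
  obtain A where A: "A > 0" "\<And>x. x \<in> {0..l} \<Longrightarrow> norm (a x) \<le> A"
    using compact_imp_bounded[OF compact_continuous_image[OF ac compact_Icc]]
    unfolding bounded_pos by auto
  let ?J = "integral {0..l} (\<lambda>x. norm (g x))"
  let ?I = "\<lambda>n. integral {0..l} (\<lambda>x. norm (gn n x - g x))"
  let ?R = "\<lambda>n. integral {0..l} (\<lambda>x. norm (an n x * gn n x - a x * g x))"
  have agn: "(\<lambda>x. an n x * gn n x) absolutely_integrable_on {0..l}"
    and ag: "(\<lambda>x. a x * g x) absolutely_integrable_on {0..l}" for n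
    by (intro abs_int_mult_continuous gn ga an ac)+
  have nn: "0 \<le> ?R n" "0 \<le> ?I n" for n
    using set_integral_diff(1)[OF agn ag, of n] set_integral_diff(1)[OF gn ga, of n]
    by (auto intro!: integral_nonneg simp: absolutely_integrable_on_def)
  have est: "?R n \<le> (A + d) * ?I n + d * ?J"
    if d: "d > 0" and n: "\<And>x. x \<in> {0..l} \<Longrightarrow> norm (an n x - a x) \<le> d" for n d
  proof -
    have i: "(\<lambda>x. norm (gn n x - g x)) integrable_on {0..l}" "(\<lambda>x. norm (g x)) integrable_on {0..l}"
      "(\<lambda>x. norm (an n x * gn n x - a x * g x)) integrable_on {0..l}"
      using set_integral_diff(1)[OF gn ga, of n] ga set_integral_diff(1)[OF agn ag, of n]
      unfolding absolutely_integrable_on_def by blast+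
    have "?R n \<le> integral {0..l} (\<lambda>x. (A + d) * norm (gn n x - g x) + d * norm (g x))"
    proof (rule integral_le[OF i(3)])
      show "(\<lambda>x. (A + d) * norm (gn n x - g x) + d * norm (g x)) integrable_on {0..l}"
        by (intro integrable_add integrable_on_mult_right i)
      fix x assume x: "x \<in> {0..l}"
      have "norm (an n x) \<le> A + d"
        using n[OF x] A(2)[OF x] norm_triangle_ineq[of "an n x - a x" "a x"] by simp
      then have "norm (an n x * (gn n x - g x)) + norm ((an n x - a x) * g x)
          \<le> (A + d) * norm (gn n x - g x) + d * norm (g x)"
        using n[OF x] unfolding norm_mult by (intro add_mono mult_right_mono) auto
      moreover have "an n x * gn n x - a x * g x = an n x * (gn n x - g x) + (an n x - a x) * g x"
        by (simp add: algebra_simps)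
      ultimately show "norm (an n x * gn n x - a x * g x) \<le> (A + d) * norm (gn n x - g x) + d * norm (g x)"
        by (metis norm_triangle_ineq order_trans)
    qed
    also have "\<dots> = (A + d) * ?I n + d * ?J"
      using i by (simp add: Henstock_Kurzweil_Integration.integral_add integrable_on_mult_right)
    finally show ?thesis .
  qed
  have J: "0 \<le> ?J"
    using ga by (auto intro!: integral_nonneg simp: absolutely_integrable_on_def)
  have "?R \<longlonglongrightarrow> 0"
  proof (rule tendstoI)
    fix e :: real assume e: "e > 0"
    \<comment> \<open>The 1 in the denominator covers \<open>?J = 0\<close> and keeps
      \<open>d * ?J\<close> strictly below \<open>e / 2\<close>.\<close>
    define d where "d = e / (2 * (?J + 1))"
    have d: "d > 0" using e J by (simp add: d_def)
    have dJ: "d * ?J < e / 2"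
    proof -
      have "d * ?J < d * (?J + 1)" using d by simp
      also have "\<dots> = e / 2" using J by (simp add: d_def field_simps)
      finally show ?thesis .
    qed
    have "(\<lambda>n. (A + d) * ?I n) \<longlonglongrightarrow> (A + d) * 0"
      by (intro tendsto_intros lim)
    then have "\<forall>\<^sub>F n in sequentially. (A + d) * ?I n < e / 2"
      using e by (intro order_tendstoD(2)) auto
    moreover have "\<forall>\<^sub>F n in sequentially. \<forall>x\<in>{0..l}. dist (an n x) (a x) < d"
      using uniform_limitD[OF a d] .
    ultimately show "\<forall>\<^sub>F n in sequentially. dist (?R n) 0 < e"
    proof eventually_elim
      case (elim n)
      then have "?R n \<le> (A + d) * ?I n + d * ?J"
        by (intro est d) (auto simp: dist_norm less_imp_le)
      then show ?case using elim(1) dJ nn(1)[of n] by simp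
    qed
  qed
  then show ?thesis
    using agn ag unfolding L1_lim_def by auto
qed

lemma L1_lim_add:
  assumes "L1_lim l gn g" "L1_lim l hn h"
  shows "L1_lim l (\<lambda>n x. gn n x + hn n x) (\<lambda>x. g x + h x)"
proof -
  have gn: "gn n absolutely_integrable_on {0..l}" and g: "g absolutely_integrable_on {0..l}"
    and hn: "hn n absolutely_integrable_on {0..l}" and h: "h absolutely_integrable_on {0..l}"
    and lim: "(\<lambda>n. integral {0..l} (\<lambda>x. norm (gn n x - g x))) \<longlonglongrightarrow> 0"
      "(\<lambda>n. integral {0..l} (\<lambda>x. norm (hn n x - h x))) \<longlonglongrightarrow> 0" for n
    using assms unfolding L1_lim_def by auto
  let ?R = "\<lambda>n. integral {0..l} (\<lambda>x. norm (gn n x + hn n x - (g x + h x)))"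
  have s: "(\<lambda>x. gn n x + hn n x) absolutely_integrable_on {0..l}"
    "(\<lambda>x. g x + h x) absolutely_integrable_on {0..l}" for n
    using gn g hn h by (auto intro: set_integral_add(1))
  have i: "(\<lambda>x. norm (gn n x - g x)) integrable_on {0..l}" "(\<lambda>x. norm (hn n x - h x)) integrable_on {0..l}"
      "(\<lambda>x. norm (gn n x + hn n x - (g x + h x))) integrable_on {0..l}" for n
    using set_integral_diff(1)[OF gn g, of n] set_integral_diff(1)[OF hn h, of n]
      set_integral_diff(1)[OF s, of n]
    unfolding absolutely_integrable_on_def by blast+
  have "?R n \<le> integral {0..l} (\<lambda>x. norm (gn n x - g x) + norm (hn n x - h x))" for n
    by (intro integral_le i integrable_add) (metis add_diff_add norm_triangle_ineq)
  then have "?R n \<le> integral {0..l} (\<lambda>x. norm (gn n x - g x)) + integral {0..l} (\<lambda>x. norm (hn n x - h x))" for n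
    using i by (simp add: Henstock_Kurzweil_Integration.integral_add)
  moreover have "0 \<le> ?R n" for n by (intro integral_nonneg i) auto
  moreover have "(\<lambda>n. integral {0..l} (\<lambda>x. norm (gn n x - g x)) + integral {0..l} (\<lambda>x. norm (hn n x - h x))) \<longlonglongrightarrow> 0"
    using tendsto_add[OF lim] by simp
  ultimately have "?R \<longlonglongrightarrow> 0"
    by (intro tendsto_sandwich[of "\<lambda>_. 0" ?R]) simp_all
  then show ?thesis using s unfolding L1_lim_def by auto
qed

lemma L1_lim_uminus:
  assumes "L1_lim l gn g"
  shows "L1_lim l (\<lambda>n x. - gn n x) (\<lambda>x. - g x)"
proof -
  have "norm (- gn n x - - g x) = norm (gn n x - g x)" for n x
    by (metis minus_diff_minus norm_minus_cancel)
  moreover have "(\<lambda>x. - h x) absolutely_integrable_on {0..l}"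
    if "h absolutely_integrable_on {0..l}" for h :: "real \<Rightarrow> complex"
    using that by (simp add: absolutely_integrable_on_def integrable_neg)
  ultimately show ?thesis
    using assms unfolding L1_lim_def by simp
qed

section \<open>Absolutely continuous functions\<close>

text \<open>Absolute continuity with derivative \<open>g\<close>, encoded by the integral identity
  rather than by differentiability almost everywhere. Only the class of \<open>g\<close> modulo null
  sets matters, while the identity for \<open>y\<close> holds at every point, as initial values
  require.\<close>

definition primitive_on :: "real \<Rightarrow> (real \<Rightarrow> complex) \<Rightarrow> (real \<Rightarrow> complex) \<Rightarrow> bool" where
  "primitive_on l y g \<longleftrightarrow> g absolutely_integrable_on {0..l} \<and> (\<forall>x\<in>{0..l}. y x = y 0 + integral {0..x} g)"

lemma primitive_onD:
  assumes "primitive_on l y g"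
  shows "x \<in> {0..l} \<Longrightarrow> y x = y 0 + integral {0..x} g" and "g absolutely_integrable_on {0..l}"
  using assms unfolding primitive_on_def by blast+

lemma primitive_on_continuous:
  assumes "primitive_on l y g"
  shows "continuous_on {0..l} y"
proof -
  have "continuous_on {0..l} (\<lambda>x. y 0 + integral {0..x} g)"
    using primitive_onD(2)[OF assms] unfolding absolutely_integrable_on_def
    by (intro continuous_intros indefinite_integral_continuous_1) blast
  then show ?thesis
    by (rule continuous_on_eq) (rule primitive_onD(1)[OF assms, symmetric])
qed

lemma primitive_on_C1:
  assumes "\<And>x. x \<in> {0..l} \<Longrightarrow> (y has_vector_derivative g x) (at x within {0..l})"
    and "continuous_on {0..l} g"
  shows "primitive_on l y g"
  unfolding primitive_on_def
proof (intro conjI ballI)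
  show "g absolutely_integrable_on {0..l}"
    by (rule absolutely_integrable_continuous_real[OF assms(2)])
  fix x assume x: "x \<in> {0..l}"
  have "(g has_integral (y x - y 0)) {0..x}"
  proof (rule fundamental_theorem_of_calculus)
    fix t assume "t \<in> {0..x}"
    then show "(y has_vector_derivative g t) (at t within {0..x})"
      using x by (intro has_vector_derivative_within_subset[OF assms(1)]) auto
  qed (use x in auto)
  then show "y x = y 0 + integral {0..x} g" by (simp add: integral_unique)
qed

text \<open>Differentiation is a closed operator: L1 convergence of the derivatives and pointwise
  convergence of the functions suffice. Through this lemma calculus rules pass from C1 functions to
  absolutely continuous ones.\<close>

lemma primitive_on_limit:
  assumes "\<And>n. primitive_on l (yn n) (gn n)" "L1_lim l gn g"
    and "\<And>x. x \<in> {0..l} \<Longrightarrow> (\<lambda>n. yn n x) \<longlonglongrightarrow> y x"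
  shows "primitive_on l y g"
  unfolding primitive_on_def
proof (intro conjI ballI)
  show "g absolutely_integrable_on {0..l}" using assms(2) by (simp add: L1_lim_def)
  fix x assume x: "x \<in> {0..l}"
  have "(\<lambda>n. yn n 0 + integral {0..x} (gn n)) \<longlonglongrightarrow> y 0 + integral {0..x} g"
    using x by (intro tendsto_intros assms(3) L1_lim_integral[OF assms(2)]) auto
  moreover have "yn n 0 + integral {0..x} (gn n) = yn n x" for n
    using primitive_onD(1)[OF assms(1) x] by simp
  ultimately show "y x = y 0 + integral {0..x} g"
    using LIMSEQ_unique[OF assms(3)[OF x]] by simp
qed

definition C1_approximation ::
    "real \<Rightarrow> (real \<Rightarrow> complex) \<Rightarrow> (real \<Rightarrow> complex) \<Rightarrow>
     (nat \<Rightarrow> real \<Rightarrow> complex) \<Rightarrow> (nat \<Rightarrow> real \<Rightarrow> complex) \<Rightarrow> bool" where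
  "C1_approximation l y g yn gn \<longleftrightarrow> (\<forall>n. continuous_on {0..l} (gn n)) \<and>
     (\<forall>n. \<forall>x\<in>{0..l}. (yn n has_vector_derivative gn n x) (at x within {0..l})) \<and>
     uniform_limit {0..l} yn y sequentially \<and> L1_lim l gn g"

lemma C1_approximationD:
  assumes "C1_approximation l y g yn gn"
  shows "continuous_on {0..l} (gn n)"
    and "x \<in> {0..l} \<Longrightarrow> (yn n has_vector_derivative gn n x) (at x within {0..l})"
    and "uniform_limit {0..l} yn y sequentially" and "L1_lim l gn g"
    and "continuous_on {0..l} (yn n)"
proof -
  show *: "x \<in> {0..l} \<Longrightarrow> (yn n has_vector_derivative gn n x) (at x within {0..l})" for x
    using assms unfolding C1_approximation_def by blast
  show "continuous_on {0..l} (yn n)"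
    unfolding continuous_on_eq_continuous_within
    by (intro ballI has_vector_derivative_continuous[OF *])
qed (use assms in \<open>unfold C1_approximation_def, blast+\<close>)

text \<open>Continuous L1 approximants of \<open>g\<close> are integrated from the common initial
  value \<open>y 0\<close>, so the uniform error is at most the L1 error of the derivatives.\<close>

lemma primitive_on_C1_approximation:
  assumes y: "primitive_on l y g"
  shows "\<exists>yn gn. C1_approximation l y g yn gn"
proof -
  have "g absolutely_integrable_on {0..l}" by (rule primitive_onD(2)[OF y])
  then obtain gn where gn: "\<And>n. continuous_on UNIV (gn n)" "L1_lim l gn g"
    using L1_lim_continuous_exists by metis
  have gc: "continuous_on {0..l} (gn n)" for n by (rule continuous_on_subset[OF gn(1)]) simp
  define yn where "yn n x = y 0 + integral {0..x} (gn n)" for n x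
  have "C1_approximation l y g yn gn"
    unfolding C1_approximation_def
  proof (intro conjI allI ballI)
    show "(yn n has_vector_derivative gn n x) (at x within {0..l})" if "x \<in> {0..l}" for n x
      unfolding yn_def using integral_has_vector_derivative[OF gc that, of n]
      by (auto intro!: derivative_eq_intros)
    show "uniform_limit {0..l} yn y sequentially"
    proof (rule uniform_limitI)
      fix e :: real assume "e > 0"
      then have "\<forall>\<^sub>F n in sequentially. integral {0..l} (\<lambda>x. norm (gn n x - g x)) < e"
        using order_tendstoD(2)[of _ 0 sequentially e] gn(2) unfolding L1_lim_def by blast
      then show "\<forall>\<^sub>F n in sequentially. \<forall>x\<in>{0..l}. dist (yn n x) (y x) < e"
      proof eventually_elim
        case (elim n)
        show ?case
        proof
          fix x assume x: "x \<in> {0..l}"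
          have "yn n x - y x = integral {0..x} (gn n) - integral {0..x} g"
            using primitive_onD(1)[OF y x] unfolding yn_def by simp
          then show "dist (yn n x) (y x) < e"
            using L1_lim_integral(2)[OF gn(2) x, of n] elim by (simp add: dist_norm)
        qed
      qed
    qed
  qed (rule gc gn(2))+
  then show ?thesis by blast
qed

lemma primitive_on_mult:
  assumes y: "primitive_on l y g" and z: "primitive_on l z h"
  shows "primitive_on l (\<lambda>x. y x * z x) (\<lambda>x. y x * h x + z x * g x)"
proof -
  obtain yn gn where "C1_approximation l y g yn gn"
    using primitive_on_C1_approximation[OF y] by blast
  note yn = C1_approximationD[OF this]
  obtain zn hn where "C1_approximation l z h zn hn"
    using primitive_on_C1_approximation[OF z] by blast
  note zn = C1_approximationD[OF this]
  show ?thesis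
  proof (rule primitive_on_limit)
    show "primitive_on l (\<lambda>x. yn n x * zn n x) (\<lambda>x. yn n x * hn n x + zn n x * gn n x)" for n
      by (intro primitive_on_C1 continuous_intros yn zn)
         (auto intro!: derivative_eq_intros yn(2) zn(2) simp: mult.commute)
    \<comment> \<open>Each summand pairs a uniformly convergent factor with an L1-convergent
      one.\<close>
    show "L1_lim l (\<lambda>n x. yn n x * hn n x + zn n x * gn n x) (\<lambda>x. y x * h x + z x * g x)"
      by (intro L1_lim_add L1_lim_mult yn zn)
    show "(\<lambda>n. yn n x * zn n x) \<longlonglongrightarrow> y x * z x" if "x \<in> {0..l}" for x
      using that by (intro tendsto_intros tendsto_uniform_limitI[OF yn(3)] tendsto_uniform_limitI[OF zn(3)])
  qed
qed

lemma primitive_on_inverse: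
  assumes y: "primitive_on l y g" and nz: "\<And>x. x \<in> {0..l} \<Longrightarrow> y x \<noteq> 0"
  shows "primitive_on l (\<lambda>x. 1 / y x) (\<lambda>x. - (1 / (y x)\<^sup>2 * g x))"
proof -
  obtain yn gn where "C1_approximation l y g yn gn"
    using primitive_on_C1_approximation[OF y] by blast
  note yn = C1_approximationD[OF this]
  have yc: "continuous_on {0..l} y" by (rule primitive_on_continuous[OF y])
  show ?thesis
  proof (cases "{0..l} = {}")
    case True
    then show ?thesis by (simp add: primitive_on_def absolutely_integrable_negligible)
  next
    case False
    obtain m where m: "m > 0" "\<And>x. x \<in> {0..l} \<Longrightarrow> m \<le> norm (y x)"
    proof -
      obtain x0 where "x0 \<in> {0..l}" "\<And>x. x \<in> {0..l} \<Longrightarrow> norm (y x0) \<le> norm (y x)"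
        using continuous_attains_inf[OF compact_Icc False continuous_on_norm[OF yc]] by blast
      then show thesis using that[of "norm (y x0)"] nz by auto
    qed
    have inv: "uniform_limit {0..l} (\<lambda>n x. inverse (yn n x)) (\<lambda>x. inverse (y x)) sequentially"
      using uniform_lim_inverse[OF yn(3) m(2,1)] by (simp add: o_def)
    have bd: "bounded ((\<lambda>x. inverse (y x)) ` {0..l})"
      using yc nz by (intro compact_imp_bounded compact_continuous_image continuous_intros) auto
    have inv2: "uniform_limit {0..l} (\<lambda>n x. inverse (yn n x) * inverse (yn n x))
        (\<lambda>x. inverse (y x) * inverse (y x)) sequentially"
      by (rule uniform_lim_mult[OF inv inv bd bd])
    have "\<forall>\<^sub>F n in sequentially. \<forall>x\<in>{0..l}. dist (yn n x) (y x) < m"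
      using uniform_limitD[OF yn(3) m(1)] .
    then obtain N where N: "\<And>n x. n \<ge> N \<Longrightarrow> x \<in> {0..l} \<Longrightarrow> dist (yn n x) (y x) < m"
      unfolding eventually_sequentially by blast
    \<comment> \<open>Early approximants may have zeros. From index \<open>N\<close> on they are
      closer than \<open>m\<close> to \<open>y\<close>, whose modulus is at least \<open>m\<close>;
      hence the shift by \<open>N\<close>.\<close>
    have ynz: "yn (n + N) x \<noteq> 0" if "x \<in> {0..l}" for n x
      using N[of "n + N" x] m(2)[of x] that by (auto simp: dist_norm)
    have shift: "uniform_limit {0..l} (\<lambda>n x. inverse (yn (n + N) x) * inverse (yn (n + N) x))
        (\<lambda>x. inverse (y x) * inverse (y x)) sequentially"
      using inv2 unfolding uniform_limit_iff eventually_sequentially by (meson trans_le_add1)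
    have L1s: "L1_lim l (\<lambda>n. gn (n + N)) g"
      using yn(4) LIMSEQ_ignore_initial_segment[of "\<lambda>n. integral {0..l} (\<lambda>x. norm (gn n x - g x))" 0 N]
      unfolding L1_lim_def by auto
    have c2: "continuous_on {0..l} (\<lambda>x. inverse (yn (n + N) x) * inverse (yn (n + N) x))" for n
      using ynz by (intro continuous_intros yn) auto
    have "primitive_on l (\<lambda>x. inverse (y x)) (\<lambda>x. - (inverse (y x) * inverse (y x) * g x))"
    proof (rule primitive_on_limit)
      show "primitive_on l (\<lambda>x. inverse (yn (n + N) x))
          (\<lambda>x. - (inverse (yn (n + N) x) * inverse (yn (n + N) x) * gn (n + N) x))" for n
      proof (rule primitive_on_C1)
        fix x assume x: "x \<in> {0..l}"
        have "((inverse \<circ> yn (n + N)) has_vector_derivative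
            gn (n + N) x * - (inverse (yn (n + N) x) ^ Suc (Suc 0))) (at x within {0..l})"
          by (rule field_vector_diff_chain_within[OF yn(2)[OF x]])
             (use DERIV_inverse[OF ynz[OF x]] in \<open>auto intro: has_field_derivative_at_within simp: power2_eq_square\<close>)
        then show "((\<lambda>x. inverse (yn (n + N) x)) has_vector_derivative
            - (inverse (yn (n + N) x) * inverse (yn (n + N) x) * gn (n + N) x)) (at x within {0..l})"
          by (simp add: o_def mult.commute mult.left_commute)
      qed (intro continuous_intros c2 yn)
      show "L1_lim l (\<lambda>n x. - (inverse (yn (n + N) x) * inverse (yn (n + N) x) * gn (n + N) x))
          (\<lambda>x. - (inverse (y x) * inverse (y x) * g x))"
        by (intro L1_lim_uminus L1_lim_mult shift c2 L1s)
      show "(\<lambda>n. inverse (yn (n + N) x)) \<longlonglongrightarrow> inverse (y x)" if "x \<in> {0..l}" for x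
        using that by (intro LIMSEQ_ignore_initial_segment tendsto_uniform_limitI[OF inv])
    qed
    then show ?thesis by (simp add: field_simps power2_eq_square)
  qed
qed

lemma primitive_on_add_integral:
  assumes "g absolutely_integrable_on {0..l}"
  shows "primitive_on l (\<lambda>x. c + integral {0..x} g) g"
  using assms by (simp add: primitive_on_def)

section \<open>The du Bois-Reymond lemma\<close>

text \<open>The ideal test function is the bounded \<open>s = cnj h / (1 + norm h)\<close>, because
  \<open>s * h = norm h ^ 2 / (1 + norm h)\<close> is nonnegative and vanishes only where
  \<open>h\<close> does. It is reached as an almost everywhere limit of uniformly bounded continuous
  functions. The 1 in the denominator makes \<open>s\<close> a continuous function of
  \<open>h\<close>, hence measurable.\<close>

lemma AE_zero_if_orthogonal_to_continuous:
  fixes h :: "real \<Rightarrow> complex"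
  assumes h: "h absolutely_integrable_on {0..l}"
    and orth: "\<And>c :: real \<Rightarrow> complex. continuous_on UNIV c \<Longrightarrow> integral {0..l} (\<lambda>x. c x * h x) = 0"
  shows "AE x in lebesgue_on {0..l}. h x = 0"
proof -
  define s where "s x = cnj (h x) / of_real (1 + norm (h x))" for x
  have hm: "h \<in> borel_measurable (lebesgue_on {0..l})"
    using h by (intro absolutely_integrable_imp_borel_measurable) auto
  have sm: "s \<in> borel_measurable (lebesgue_on {0..l})"
  proof -
    have "continuous_on UNIV (\<lambda>z. cnj z / complex_of_real (1 + norm z))"
      by (intro continuous_intros ballI) (metis add_pos_nonneg norm_ge_zero of_real_eq_0_iff order_less_irrefl zero_less_one)
    then have "(\<lambda>z. cnj z / complex_of_real (1 + norm z)) \<in> borel_measurable borel"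
      by (rule borel_measurable_continuous_onI)
    from measurable_compose[OF hm this] show ?thesis unfolding s_def .
  qed
  have sb: "norm (s x) \<le> 1" for x
  proof -
    have "norm (s x) = norm (h x) / (1 + norm (h x))"
      unfolding s_def norm_divide norm_of_real complex_mod_cnj by simp
    also have "\<dots> \<le> 1" by (simp add: divide_le_eq_1 add_pos_nonneg)
    finally show ?thesis .
  qed
  obtain c N where c: "\<And>n. continuous_on UNIV (c n)" "\<And>n x. norm (c n x :: complex) \<le> 1"
    "negligible N" "\<And>x. x \<in> {0..l} - N \<Longrightarrow> (\<lambda>n. c n x) \<longlonglongrightarrow> s x"
    by (rule continuous_bounded_approximation[OF sm _ sb]) auto
  have hi: "(\<lambda>x. 2 * norm (h x)) integrable_on {0..l}"
    using h unfolding absolutely_integrable_on_def by (intro integrable_on_mult_right) blast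
  have ch: "(\<lambda>x. c n x * h x) absolutely_integrable_on {0..l}" for n
    by (intro abs_int_mult_continuous h continuous_on_subset[OF c(1)]) simp
  have sh: "(\<lambda>x. s x * h x) absolutely_integrable_on {0..l}"
    by (rule absolutely_integrable_bounded_measurable_product[OF bilinear_times sm _ _ h])
       (use sb in \<open>auto intro: boundedI\<close>)
  have "L1_lim l (\<lambda>n x. c n x * h x) (\<lambda>x. s x * h x)"
  proof (rule L1_lim_dominated[OF ch hi sh _ c(3)])
    fix n x
    have "norm (c n x - s x) \<le> 2"
      using norm_triangle_ineq4[of "c n x" "s x"] c(2)[of n x] sb[of x] by simp
    then have "norm (c n x - s x) * norm (h x) \<le> 2 * norm (h x)"
      by (intro mult_right_mono) auto
    then show "norm (c n x * h x - s x * h x) \<le> 2 * norm (h x)"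
      by (metis left_diff_distrib norm_mult)
  next
    show "(\<lambda>n. c n x * h x) \<longlonglongrightarrow> s x * h x" if "x \<in> {0..l} - N" for x
      by (intro tendsto_intros c(4) that)
  qed
  then have lim: "(\<lambda>n. integral {0..x} (\<lambda>x. c n x * h x)) \<longlonglongrightarrow> integral {0..x} (\<lambda>x. s x * h x)" if "x \<in> {0..l}" for x
    by (rule L1_lim_integral(1)[OF _ that])
  have zero: "integral {0..l} (\<lambda>x. s x * h x) = 0"
  proof (cases "0 \<le> l")
    case True
    then show ?thesis
      using lim[of l] orth[OF c(1)] by (simp add: LIMSEQ_const_iff)
  qed simp
  define r where "r x = (norm (h x))\<^sup>2 / (1 + norm (h x))" for x
  have sr: "s x * h x = of_real (r x)" for x
    by (simp add: s_def r_def complex_norm_square mult.commute del: of_real_power)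
  have ri: "r absolutely_integrable_on {0..l}"
    using absolutely_integrable_linear[OF sh bounded_linear_Re] by (simp add: o_def sr)
  have "integral {0..l} r = Re (integral {0..l} (\<lambda>x. s x * h x))"
    using integral_linear[OF _ bounded_linear_Re, of "\<lambda>x. s x * h x" "{0..l}"] sh
    by (simp add: o_def sr absolutely_integrable_on_def)
  then have r0: "integral {0..l} r = 0" using zero by simp
  have rL: "integrable (lebesgue_on {0..l}) r"
    by (rule absolutely_integrable_imp_integrable[OF ri]) simp
  have "integral\<^sup>L (lebesgue_on {0..l}) r = 0"
    using lebesgue_integral_eq_integral[OF rL] r0 by simp
  moreover have "AE x in lebesgue_on {0..l}. 0 \<le> r x"
    by (simp add: r_def)
  ultimately have "AE x in lebesgue_on {0..l}. r x = 0"
    using integral_nonneg_eq_0_iff_AE[OF rL] by blast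
  then show ?thesis
  proof (rule AE_mp, intro AE_I2 impI)
    fix x assume "r x = 0"
    moreover have "1 + norm (h x) \<noteq> 0" by (metis add_pos_nonneg norm_ge_zero order_less_irrefl zero_less_one)
    ultimately show "h x = 0" by (simp add: r_def)
  qed
qed

text \<open>The zero function is a primitive of \<open>h\<close>, so the product rule against a
  polynomial shows that \<open>h\<close> is orthogonal to it; Weierstrass approximation extends this
  to all continuous functions.\<close>

lemma AE_zero_if_integral_zero:
  fixes h :: "real \<Rightarrow> complex"
  assumes l: "0 \<le> l" and h: "h absolutely_integrable_on {0..l}"
    and zero: "\<And>x. x \<in> {0..l} \<Longrightarrow> integral {0..x} h = 0"
  shows "AE x in lebesgue_on {0..l}. h x = 0"
proof (rule AE_zero_if_orthogonal_to_continuous[OF h])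
  fix c :: "real \<Rightarrow> complex" assume "continuous_on UNIV c"
  then have c: "continuous_on {0..l} c" by (rule continuous_on_subset) simp
  have p0: "primitive_on l (\<lambda>_. 0) h"
    unfolding primitive_on_def using h zero by simp
  obtain g where g: "uniform_limit {0..l} g c sequentially" "\<And>n. polynomial_function (g n)"
    using Stone_Weierstrass_uniform_limit[OF compact_Icc c] by blast
  have gc: "continuous_on {0..l} (g n)" for n
    using g(2) by (intro continuous_on_polymonial_function)
  have "integral {0..l} (\<lambda>x. g n x * h x) = 0" for n
  proof -
    obtain g' where g': "polynomial_function g'" "\<And>x. (g n has_vector_derivative g' x) (at x)"
      using has_vector_derivative_polynomial_function[OF g(2)] by blast
    have "primitive_on l (g n) g'"
      by (intro primitive_on_C1 has_vector_derivative_at_within[OF g'(2)]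
          continuous_on_polymonial_function g'(1))
    from primitive_onD(1)[OF primitive_on_mult[OF p0 this], of l] show ?thesis
      using l by simp
  qed
  moreover have "L1_lim l (\<lambda>n x. g n x * h x) (\<lambda>x. c x * h x)"
    by (rule L1_lim_mult[OF g(1) gc]) (simp add: L1_lim_def h)
  ultimately show "integral {0..l} (\<lambda>x. c x * h x) = 0"
    using L1_lim_integral(1)[of l "\<lambda>n x. g n x * h x" "\<lambda>x. c x * h x" l] l by (simp add: LIMSEQ_const_iff)
qed

lemma test_functionsD:
  assumes "\<phi> \<in> test_functions l"
  shows "(\<phi> has_vector_derivative vector_derivative \<phi> (at x)) (at x)"
    and "continuous_on UNIV (\<lambda>x. vector_derivative \<phi> (at x))"
    and "continuous_on UNIV \<phi>" and "\<phi> 0 = 0" and "\<phi> l = 0"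
proof -
  have "\<phi> C1_differentiable_on UNIV"
    and supp: "\<exists>C. compact C \<and> C \<subseteq> {0<..<l} \<and> (\<forall>x. x \<notin> C \<longrightarrow> \<phi> x = 0)"
    using assms unfolding test_functions_def by blast+
  then have d: "\<forall>x. \<phi> differentiable at x" and "continuous_on UNIV (\<lambda>x. vector_derivative \<phi> (at x))"
    unfolding C1_differentiable_on_eq by auto
  then show "continuous_on UNIV (\<lambda>x. vector_derivative \<phi> (at x))" by blast
  show "(\<phi> has_vector_derivative vector_derivative \<phi> (at x)) (at x)" for x
    using d vector_derivative_works by blast
  show "continuous_on UNIV \<phi>"
    using d by (simp add: continuous_at_imp_continuous_on differentiable_imp_continuous_within)
  show "\<phi> 0 = 0" "\<phi> l = 0" using supp by force+
qed

text \<open>The antiderivative vanishing at 0 is constant left of \<open>\<alpha>\<close> and right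
  of \<open>\<beta>\<close>, and the zero mean makes the right-hand constant 0 as well. It is taken
  on the whole line because test functions are C1 on \<open>UNIV\<close>.\<close>

lemma test_function_with_derivative:
  fixes \<psi> :: "real \<Rightarrow> complex"
  assumes l: "0 < l" and \<psi>: "continuous_on UNIV \<psi>" "integral {0..l} \<psi> = 0"
    and supp: "0 < \<alpha>" "\<beta> < l" "\<And>x. x \<le> \<alpha> \<Longrightarrow> \<psi> x = 0" "\<And>x. x \<ge> \<beta> \<Longrightarrow> \<psi> x = 0"
  shows "\<exists>\<phi>\<in>test_functions l. \<forall>x. vector_derivative \<phi> (at x) = \<psi> x"
proof -
  have "\<exists>F. \<forall>x. -\<infinity> < ereal x \<longrightarrow> ereal x < \<infinity> \<longrightarrow> (F has_vector_derivative \<psi> x) (at x)"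
    by (rule einterval_antiderivative)
       (use \<psi>(1) in \<open>auto simp: continuous_on_eq_continuous_at\<close>)
  then obtain F where F: "\<And>x. (F has_vector_derivative \<psi> x) (at x)" by auto
  define \<phi> where "\<phi> x = F x - F 0" for x
  have d: "(\<phi> has_vector_derivative \<psi> x) (at x)" for x
    unfolding \<phi>_def using F by (auto intro!: derivative_eq_intros)
  have left: "\<phi> x = \<phi> 0" if "x \<le> \<alpha>" for x
  proof -
    have "(\<phi> has_vector_derivative 0) (at x within {..\<alpha>})" if "x \<in> {..\<alpha>}" for x
      using has_vector_derivative_at_within[OF d] supp(3) that by (metis atMost_iff)
    then obtain c where "\<And>x. x \<in> {..\<alpha>} \<Longrightarrow> \<phi> x = c"
      using has_vector_derivative_zero_constant[OF convex_real_interval(2)] by metis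
    then show ?thesis using that supp(1) by simp
  qed
  have "(\<psi> has_integral (\<phi> l - \<phi> 0)) {0..l}"
    by (rule fundamental_theorem_of_calculus) (use l d in \<open>auto intro: has_vector_derivative_at_within\<close>)
  then have l0: "\<phi> l = \<phi> 0" using \<psi>(2) by (simp add: has_integral_integrable_integral)
  have right: "\<phi> x = \<phi> l" if "x \<ge> \<beta>" for x
  proof -
    have "(\<phi> has_vector_derivative 0) (at x within {\<beta>..})" if "x \<in> {\<beta>..}" for x
      using has_vector_derivative_at_within[OF d] supp(4) that by (metis atLeast_iff)
    then obtain c where "\<And>x. x \<in> {\<beta>..} \<Longrightarrow> \<phi> x = c"
      using has_vector_derivative_zero_constant[OF convex_real_interval(1)] by metis
    then show ?thesis using that supp(2) by simp
  qed
  have vd: "vector_derivative \<phi> (at x) = \<psi> x" for x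
    by (rule vector_derivative_at[OF d])
  have "\<phi> C1_differentiable_on UNIV"
    unfolding C1_differentiable_on_def using d \<psi>(1) by blast
  moreover have "\<phi> x = 0" if "x \<notin> {\<alpha>..\<beta>}" for x
    using that left[of x] right[of x] l0 by (cases "x < \<alpha>") (auto simp: \<phi>_def)
  moreover have "{\<alpha>..\<beta>} \<subseteq> {0<..<l}" using supp(1,2) by auto
  ultimately have "\<phi> \<in> test_functions l"
    unfolding test_functions_def by (blast intro: compact_Icc)
  then show ?thesis using vd by blast
qed

text \<open>
  Du Bois-Reymond: with cut-offs \<open>T n \<longlonglongrightarrow> 1\<close>, the function \<open>c T n (\<integral>T n) - T n (\<integral>c T n)\<close> has mean
  zero and is therefore the derivative of a test function; in the limit, \<open>v - (\<integral>v)/l\<close> is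
  orthogonal to every continuous \<open>c\<close>.
\<close>

lemma du_Bois_Reymond:
  fixes v :: "real \<Rightarrow> complex"
  assumes l: "0 < l" and v: "v absolutely_integrable_on {0..l}"
    and orth: "\<And>\<phi>. \<phi> \<in> test_functions l \<Longrightarrow> integral {0..l} (\<lambda>x. vector_derivative \<phi> (at x) * v x) = 0"
  shows "AE x in lebesgue_on {0..l}. v x = integral {0..l} v / l"
proof -
  \<comment> \<open>A product of two ramps with values in [0, 1]: it is 0 within 1/(n+1) of either
    end point and 1 where both are at least 2/(n+1) away.\<close>
  define T :: "nat \<Rightarrow> real \<Rightarrow> complex" where
    "T n x = of_real (min 1 (max 0 (real (Suc n) * x - 1)) * min 1 (max 0 (real (Suc n) * (l - x) - 1)))" for n x
  have Tc: "continuous_on A (T n)" for n A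
    unfolding T_def by (intro continuous_intros)
  have Tl: "T n x = 0" if "x \<le> 1 / real (Suc n)" for n x
    using that by (simp add: T_def field_simps)
  have Tr: "T n x = 0" if "x \<ge> l - 1 / real (Suc n)" for n x
    using that by (simp add: T_def field_simps)
  have Tb: "\<exists>t. T n x = of_real t \<and> 0 \<le> t \<and> t \<le> 1" for n x
  proof (intro exI conjI)
    show "T n x = of_real (min 1 (max 0 (real (Suc n) * x - 1)) * min 1 (max 0 (real (Suc n) * (l - x) - 1)))"
      by (simp only: T_def)
  qed (auto intro: mult_le_one)
  have T1: "(\<lambda>n. T n x) \<longlonglongrightarrow> 1" if x: "x \<in> {0..l} - {0, l}" for x
  proof (rule tendsto_eventually)
    have pos: "0 < x" "0 < l - x" using x by auto
    obtain N where N: "2 / x < real N" using reals_Archimedean2 by blast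
    obtain M where M: "2 / (l - x) < real M" using reals_Archimedean2 by blast
    show "\<forall>\<^sub>F n in sequentially. T n x = 1"
      using eventually_ge_at_top[of "max N M"]
    proof eventually_elim
      case (elim n)
      have "2 / x \<le> real (Suc n)" "2 / (l - x) \<le> real (Suc n)"
        using elim N M by auto
      then have "2 \<le> real (Suc n) * x" "2 \<le> real (Suc n) * (l - x)"
        using pos by (simp_all add: pos_divide_le_eq del: of_nat_Suc)
      then show ?case by (simp add: T_def del: of_nat_Suc)
    qed
  qed
  have cut: "(\<lambda>n. integral {0..l} (\<lambda>x. T n x * w x)) \<longlonglongrightarrow> integral {0..l} w"
    if w: "w absolutely_integrable_on {0..l}" for w
  proof -
    have "L1_lim l (\<lambda>n x. T n x * w x) w"
    proof (rule L1_lim_dominated[where N = "{0, l}"])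
      show "(\<lambda>x. T n x * w x) absolutely_integrable_on {0..l}" for n
        by (intro abs_int_mult_continuous w Tc)
      show "(\<lambda>x. norm (w x)) integrable_on {0..l}" using w unfolding absolutely_integrable_on_def by blast
      show "norm (T n x * w x - w x) \<le> norm (w x)" for n x
      proof -
        obtain t where t: "T n x = of_real t" "0 \<le> t" "t \<le> 1" using Tb by blast
        have "T n x * w x - w x = of_real (t - 1) * w x" using t by (simp add: algebra_simps)
        then show ?thesis using t by (simp add: norm_mult mult_left_le_one_le flip: of_real_diff)
      qed
      show "(\<lambda>n. T n x * w x) \<longlonglongrightarrow> w x" if "x \<in> {0..l} - {0, l}" for x
        using tendsto_mult[OF T1[OF that] tendsto_const[of "w x"]] by simp
    qed (use w in auto)
    then show ?thesis using L1_lim_integral(1)[of l _ w l] l by simp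
  qed
  have "AE x in lebesgue_on {0..l}. v x - integral {0..l} v / l = 0"
  proof (rule AE_zero_if_orthogonal_to_continuous)
    show "(\<lambda>x. v x - integral {0..l} v / l) absolutely_integrable_on {0..l}"
      by (intro set_integral_diff(1) v absolutely_integrable_on_const) simp
    fix c :: "real \<Rightarrow> complex" assume cU: "continuous_on UNIV c"
    then have c: "continuous_on {0..l} c" by (rule continuous_on_subset) simp
    have ca: "c absolutely_integrable_on {0..l}" by (rule absolutely_integrable_continuous_real[OF c])
    have cv: "(\<lambda>x. c x * v x) absolutely_integrable_on {0..l}" by (rule abs_int_mult_continuous[OF v c])
    \<comment> \<open>The factor 1 gives the integrand the form \<open>T n x * w x\<close> that
      \<open>cut\<close> expects.\<close>
    define S where "S n = integral {0..l} (\<lambda>x. T n x * 1)" for n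
    define I where "I n = integral {0..l} (\<lambda>x. T n x * c x)" for n
    have rel: "S n * integral {0..l} (\<lambda>x. T n x * (c x * v x)) = I n * integral {0..l} (\<lambda>x. T n x * v x)" for n
    proof -
      have i: "(\<lambda>x. T n x * 1) integrable_on {0..l}" "(\<lambda>x. T n x * c x) integrable_on {0..l}"
        by (intro integrable_continuous_real continuous_intros Tc c)+
      have iv: "(\<lambda>x. T n x * (c x * v x)) integrable_on {0..l}" "(\<lambda>x. T n x * v x) integrable_on {0..l}"
        using abs_int_mult_continuous[OF cv Tc, of n] abs_int_mult_continuous[OF v Tc, of n]
        unfolding absolutely_integrable_on_def by blast+
      define \<psi> where "\<psi> x = S n * (T n x * c x) - I n * (T n x * 1)" for x
      have "integral {0..l} \<psi> = S n * I n - I n * S n"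
        unfolding \<psi>_def by (subst Henstock_Kurzweil_Integration.integral_diff)
          (use i in \<open>auto simp: S_def I_def intro: integrable_on_mult_right\<close>)
      then have \<psi>0: "integral {0..l} \<psi> = 0" by simp
      have "\<exists>\<phi>\<in>test_functions l. \<forall>x. vector_derivative \<phi> (at x) = \<psi> x"
      proof (rule test_function_with_derivative[OF l _ \<psi>0])
        show "continuous_on UNIV \<psi>" unfolding \<psi>_def by (intro continuous_intros Tc cU)
        show "0 < 1 / real (Suc n)" "l - 1 / real (Suc n) < l" by simp_all
        show "\<psi> x = 0" if "x \<le> 1 / real (Suc n)" for x unfolding \<psi>_def Tl[OF that] by simp
        show "\<psi> x = 0" if "l - 1 / real (Suc n) \<le> x" for x unfolding \<psi>_def Tr[OF that] by simp
      qed
      then obtain \<phi> where "\<phi> \<in> test_functions l" "\<And>x. vector_derivative \<phi> (at x) = \<psi> x" by blast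
      then have "integral {0..l} (\<lambda>x. \<psi> x * v x) = 0" using orth[of \<phi>] by simp
      moreover have "(\<lambda>x. \<psi> x * v x) = (\<lambda>x. S n * (T n x * (c x * v x)) - I n * (T n x * v x))"
        by (auto simp: \<psi>_def algebra_simps)
      ultimately show ?thesis
        using iv by (simp add: Henstock_Kurzweil_Integration.integral_diff integrable_on_mult_right)
    qed
    have "S \<longlonglongrightarrow> integral {0..l} (\<lambda>x. 1)" unfolding S_def
      by (rule cut) (intro absolutely_integrable_on_const, simp)
    then have S: "S \<longlonglongrightarrow> of_real l" using l by (simp add: scaleR_conv_of_real)
    have "(\<lambda>n. S n * integral {0..l} (\<lambda>x. T n x * (c x * v x))) \<longlonglongrightarrow> of_real l * integral {0..l} (\<lambda>x. c x * v x)"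
      by (intro tendsto_mult S cut cv)
    moreover have "(\<lambda>n. I n * integral {0..l} (\<lambda>x. T n x * v x)) \<longlonglongrightarrow> integral {0..l} c * integral {0..l} v"
      unfolding I_def by (intro tendsto_mult cut ca v)
    ultimately have "of_real l * integral {0..l} (\<lambda>x. c x * v x) = integral {0..l} c * integral {0..l} v"
      unfolding rel by (rule LIMSEQ_unique)
    moreover have "integral {0..l} (\<lambda>x. c x * (v x - integral {0..l} v / l))
        = integral {0..l} (\<lambda>x. c x * v x) - integral {0..l} c * (integral {0..l} v / l)"
      unfolding right_diff_distrib
    proof (subst Henstock_Kurzweil_Integration.integral_diff)
      show "(\<lambda>x. c x * v x) integrable_on {0..l}" "(\<lambda>x. c x * (integral {0..l} v / l)) integrable_on {0..l}"
        using ca cv unfolding absolutely_integrable_on_def by (blast intro: integrable_on_mult_left)+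
    qed simp
    ultimately show "integral {0..l} (\<lambda>x. c x * (v x - integral {0..l} v / l)) = 0"
      using l by (simp add: field_simps)
  qed
  then show ?thesis by simp
qed

section \<open>Weak derivatives\<close>

text \<open>Weak derivatives live on the open interval, primitives on the closed one; the two end
  points form a null set.\<close>

lemma AE_Icc_iff_Ioo: "(AE x in lebesgue_on {a..b}. P x) \<longleftrightarrow> (AE x in lebesgue_on {a<..<b}. P x)"
  for a b :: real
proof -
  have "(\<exists>N. negligible N \<and> (\<forall>x\<in>{a..b} - N. P x)) \<longleftrightarrow> (\<exists>N. negligible N \<and> (\<forall>x\<in>{a<..<b} - N. P x))"
    (is "?L = ?R")
  proof
    assume ?R
    then obtain N where "negligible N" "\<forall>x\<in>{a<..<b} - N. P x" by blast
    moreover have "{a..b} - (N \<union> {a, b}) \<subseteq> {a<..<b} - N" by auto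
    ultimately show ?L by (intro exI[of _ "N \<union> {a, b}"]) (auto intro: negligible_Un)
  qed (use greaterThanLessThan_subseteq_atLeastAtMost_iff[of a b a b] in blast)
  then show ?thesis by (simp add: AE_lebesgue_on_iff_negligible)
qed

lemma integral_cong_AE_lebesgue_on:
  fixes f g :: "real \<Rightarrow> complex"
  assumes ae: "AE x in lebesgue_on {0<..<l}. f x = g x" and x: "x \<le> l"
  shows "integral {0..x} f = integral {0..x} g"
proof -
  obtain N where N: "negligible N" "\<And>x. x \<in> {0..l} - N \<Longrightarrow> f x = g x"
    using ae unfolding AE_Icc_iff_Ioo[symmetric] by (auto simp: AE_lebesgue_on_iff_negligible)
  show ?thesis by (rule integral_spike[OF N(1)]) (use N(2) x in auto)
qed

lemma LINT_Ioo_eq_integral: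
  fixes h :: "real \<Rightarrow> complex"
  assumes "h absolutely_integrable_on {a..b}"
  shows "(LINT x|lebesgue_on {a<..<b}. h x) = integral {a..b} h"
proof -
  have "h absolutely_integrable_on {a<..<b}"
    using assms by (simp add: absolutely_integrable_on_Icc_iff_Ioo)
  then have "integrable (lebesgue_on {a<..<b}) h"
    by (rule absolutely_integrable_imp_integrable) simp
  then show ?thesis
    using lebesgue_integral_eq_integral[of "{a<..<b}" h] integral_open_interval_real[of a b h] by simp
qed

section \<open>Square-integrable functions on an interval\<close>

lemma L2_on_imp_abs_int:
  assumes "L2_on {a<..<b::real} y"
  shows "y absolutely_integrable_on {a..b}"
proof -
  have m: "y \<in> borel_measurable (lebesgue_on {a<..<b})"
    and i: "integrable (lebesgue_on {a<..<b}) (\<lambda>x. (cmod (y x))\<^sup>2)"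
    using assms unfolding L2_on_def by blast+
  have c: "(\<lambda>x. 1 :: real) integrable_on {a<..<b}"
    by (simp add: integrable_on_open_interval_real integrable_const_ivl)
  have "y absolutely_integrable_on {a<..<b}"
  proof (rule measurable_bounded_by_integrable_imp_absolutely_integrable[OF m])
    show "(\<lambda>x. 1 + (cmod (y x))\<^sup>2) integrable_on {a<..<b}"
      by (intro integrable_add c integrable_on_lebesgue_on[OF i]) simp
    fix x
    have "0 \<le> (cmod (y x) - 1)\<^sup>2" by simp
    then have "2 * cmod (y x) \<le> 1 + (cmod (y x))\<^sup>2" by (simp add: power2_eq_square algebra_simps)
    then show "cmod (y x) \<le> 1 + (cmod (y x))\<^sup>2"
      using norm_ge_zero[of "y x"] by linarith
  qed simp
  then show ?thesis by (simp add: absolutely_integrable_on_Icc_iff_Ioo)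
qed

lemma L2_on_bounded_by:
  assumes "y \<in> borel_measurable (lebesgue_on A)" "integrable (lebesgue_on A) h"
    and "\<And>x. x \<in> A \<Longrightarrow> (cmod (y x))\<^sup>2 \<le> h x" and "A \<in> sets lebesgue"
  shows "L2_on A y"
  unfolding L2_on_def
proof
  show "integrable (lebesgue_on A) (\<lambda>x. (cmod (y x))\<^sup>2)"
  proof (rule Bochner_Integration.integrable_bound[OF assms(2)])
    show "AE x in lebesgue_on A. norm ((cmod (y x))\<^sup>2) \<le> norm (h x)"
    proof (rule AE_I2)
      fix x assume "x \<in> space (lebesgue_on A)"
      then have "(cmod (y x))\<^sup>2 \<le> h x" using assms(3,4) by (simp add: space_restrict_space)
      then show "norm ((cmod (y x))\<^sup>2) \<le> norm (h x)" by simp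
    qed
  qed (use assms(1) in measurable)
qed fact

lemma continuous_on_imp_measurable_Ioo:
  assumes "continuous_on {0..l} (a :: real \<Rightarrow> complex)"
  shows "a \<in> borel_measurable (lebesgue_on {0<..<l})"
  by (rule continuous_imp_measurable_on_sets_lebesgue[OF continuous_on_subset[OF assms]]) auto

lemma L2_on_mult_continuous:
  fixes a :: "real \<Rightarrow> complex"
  assumes g: "L2_on {0<..<l} g" and a: "continuous_on {0..l} a"
  shows "L2_on {0<..<l} (\<lambda>x. a x * g x)"
proof -
  obtain A where A: "\<And>x. x \<in> {0..l} \<Longrightarrow> norm (a x) \<le> A"
    using compact_imp_bounded[OF compact_continuous_image[OF a compact_Icc]]
    unfolding bounded_iff by blast
  have gm: "g \<in> borel_measurable (lebesgue_on {0<..<l})"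
    and gi: "integrable (lebesgue_on {0<..<l}) (\<lambda>x. (cmod (g x))\<^sup>2)"
    using g unfolding L2_on_def by blast+
  show ?thesis
  proof (rule L2_on_bounded_by)
    show "(\<lambda>x. a x * g x) \<in> borel_measurable (lebesgue_on {0<..<l})"
      by (intro borel_measurable_times gm continuous_on_imp_measurable_Ioo a)
    show "integrable (lebesgue_on {0<..<l}) (\<lambda>x. A\<^sup>2 * (cmod (g x))\<^sup>2)"
      using gi by (rule integrable_mult_right)
    show "(cmod (a x * g x))\<^sup>2 \<le> A\<^sup>2 * (cmod (g x))\<^sup>2" if "x \<in> {0<..<l}" for x
      unfolding norm_mult power_mult_distrib
      using A[of x] that by (intro mult_right_mono power_mono) auto
  qed simp
qed

lemma L2_on_add:
  assumes g: "L2_on {0<..<l::real} g" and h: "L2_on {0<..<l} h"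
  shows "L2_on {0<..<l} (\<lambda>x. g x + h x)"
proof (rule L2_on_bounded_by)
  show "(\<lambda>x. g x + h x) \<in> borel_measurable (lebesgue_on {0<..<l})"
    using g h unfolding L2_on_def by (intro borel_measurable_add) blast+
  show "integrable (lebesgue_on {0<..<l}) (\<lambda>x. 2 * (cmod (g x))\<^sup>2 + 2 * (cmod (h x))\<^sup>2)"
    using g h unfolding L2_on_def
    by (intro Bochner_Integration.integrable_add integrable_mult_right) blast+
  show "(cmod (g x + h x))\<^sup>2 \<le> 2 * (cmod (g x))\<^sup>2 + 2 * (cmod (h x))\<^sup>2" for x
  proof -
    have "(cmod (g x + h x))\<^sup>2 \<le> (cmod (g x) + cmod (h x))\<^sup>2"
      by (intro power_mono norm_triangle_ineq norm_ge_zero)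
    moreover have "0 \<le> (cmod (g x) - cmod (h x))\<^sup>2" by simp
    ultimately show ?thesis by (simp add: power2_eq_square algebra_simps)
  qed
qed simp

lemma L2_on_continuous:
  fixes a :: "real \<Rightarrow> complex"
  assumes "continuous_on {0..l} a"
  shows "L2_on {0<..<l} a"
proof -
  have "L2_on {0<..<l} (\<lambda>_. 1)"
    unfolding L2_on_def
    using absolutely_integrable_imp_integrable[where f = "\<lambda>_. 1 :: real" and S = "{0<..<l}"] by simp
  from L2_on_mult_continuous[OF this assms] show ?thesis by simp
qed

text \<open>Lebesgue measure is complete, so measurability does not depend on the representative.
  Members of \<open>W12\<close> are arbitrary representatives of their classes.\<close>

lemma borel_measurable_cong_AE_lebesgue_on:
  fixes f g :: "real \<Rightarrow> complex"
  assumes "f \<in> borel_measurable (lebesgue_on S)" "AE x in lebesgue_on S. f x = g x" "S \<in> sets lebesgue"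
  shows "g \<in> borel_measurable (lebesgue_on S)"
proof -
  have "f measurable_on S" using assms by (simp add: measurable_on_iff_borel_measurable)
  moreover obtain N where "negligible N" "\<And>x. x \<in> S - N \<Longrightarrow> f x = g x"
    using assms(2,3) by (auto simp: AE_lebesgue_on_iff_negligible)
  ultimately have "g measurable_on S"
    by (intro measurable_on_spike[of f S N g]) auto
  then show ?thesis using assms(3) by (simp add: measurable_on_iff_borel_measurable)
qed

lemma L2_on_cong_AE:
  fixes f g :: "real \<Rightarrow> complex"
  assumes "L2_on S f" "AE x in lebesgue_on S. f x = g x" "S \<in> sets lebesgue"
  shows "L2_on S g"
proof -
  have f: "f \<in> borel_measurable (lebesgue_on S)" "integrable (lebesgue_on S) (\<lambda>x. (cmod (f x))\<^sup>2)"
    using assms unfolding L2_on_def by blast+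
  have g: "g \<in> borel_measurable (lebesgue_on S)"
    by (rule borel_measurable_cong_AE_lebesgue_on[OF f(1) assms(2,3)])
  have "AE x in lebesgue_on S. (cmod (f x))\<^sup>2 = (cmod (g x))\<^sup>2"
    using assms(2) by eventually_elim simp
  moreover have "(\<lambda>x. (cmod (g x))\<^sup>2) \<in> borel_measurable (lebesgue_on S)"
    using g by measurable
  ultimately have "integrable (lebesgue_on S) (\<lambda>x. (cmod (g x))\<^sup>2)"
    using integrable_cong_AE_imp[OF f(2)] by blast
  then show ?thesis using g unfolding L2_on_def by blast
qed

text \<open>The integral of \<open>cmod (z x - z' x)\<close> is 0, and a continuous nonnegative
  integrand with integral 0 vanishes everywhere, end points included. This gives meaning to initial
  values at 0.\<close>

lemma continuous_eq_if_AE_eq: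
  fixes z z' :: "real \<Rightarrow> complex"
  assumes l: "0 < l" and z: "continuous_on {0..l} z" "continuous_on {0..l} z'"
    and ae: "AE x in lebesgue_on {0<..<l}. z x = z' x" and x: "x \<in> {0..l}"
  shows "z x = z' x"
proof -
  obtain N where N: "negligible N" "\<And>x. x \<in> {0..l} - N \<Longrightarrow> z x = z' x"
    using ae unfolding AE_Icc_iff_Ioo[symmetric] by (auto simp: AE_lebesgue_on_iff_negligible)
  have "((\<lambda>x. 0) has_integral 0) (cbox 0 l)" by simp
  then have "((\<lambda>x. cmod (z x - z' x)) has_integral 0) (cbox 0 l)"
    by (rule has_integral_spike[OF N(1), rotated]) (use N(2) in auto)
  then have "cmod (z x - z' x) = 0"
    using l x by (intro has_integral_0_cbox_imp_0[of 0 l "\<lambda>x. cmod (z x - z' x)"])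
      (auto intro!: continuous_intros z)
  then show ?thesis by simp
qed

section \<open>Weak derivatives as integrands of primitives\<close>

lemma primitive_on_test_function:
  assumes l: "0 \<le> l" and z: "primitive_on l z g" and \<phi>: "\<phi> \<in> test_functions l"
  shows "integral {0..l} (\<lambda>x. z x * vector_derivative \<phi> (at x)) = - integral {0..l} (\<lambda>x. g x * \<phi> x)"
proof -
  note \<phi>D = test_functionsD[OF \<phi>]
  have c: "continuous_on {0..l} (\<lambda>x. vector_derivative \<phi> (at x))" "continuous_on {0..l} \<phi>"
    by (rule continuous_on_subset[OF \<phi>D(2)], simp) (rule continuous_on_subset[OF \<phi>D(3)], simp)
  have "primitive_on l \<phi> (\<lambda>x. vector_derivative \<phi> (at x))"
    by (intro primitive_on_C1 has_vector_derivative_at_within[OF \<phi>D(1)] c)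
  from primitive_onD(1)[OF primitive_on_mult[OF z this], of l]
  have "integral {0..l} (\<lambda>x. z x * vector_derivative \<phi> (at x) + \<phi> x * g x) = 0"
    using l \<phi>D(4,5) by simp
  moreover have "(\<lambda>x. z x * vector_derivative \<phi> (at x)) integrable_on {0..l}"
    by (intro integrable_continuous_real continuous_intros primitive_on_continuous[OF z] c)
  moreover have "(\<lambda>x. \<phi> x * g x) integrable_on {0..l}"
    using abs_int_mult_continuous[OF primitive_onD(2)[OF z] c(2)] unfolding absolutely_integrable_on_def by blast
  ultimately have "integral {0..l} (\<lambda>x. z x * vector_derivative \<phi> (at x)) + integral {0..l} (\<lambda>x. \<phi> x * g x) = 0"
    by (simp add: Henstock_Kurzweil_Integration.integral_add)
  then show ?thesis by (simp add: mult.commute eq_neg_iff_add_eq_0)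
qed

text \<open>The weak formulation uses the Lebesgue integral over the open interval, the calculus of
  primitives the gauge integral over the closed one. They agree here because an L2 function times a
  continuous one is absolutely integrable.\<close>

lemma test_function_pairing:
  assumes y: "L2_on {0<..<l} y" and \<phi>: "\<phi> \<in> test_functions l"
  shows "(LINT x|lebesgue_on {0<..<l}. y x * vector_derivative \<phi> (at x)) =
      integral {0..l} (\<lambda>x. y x * vector_derivative \<phi> (at x))"
    and "(LINT x|lebesgue_on {0<..<l}. y x * \<phi> x) = integral {0..l} (\<lambda>x. y x * \<phi> x)"
proof -
  note \<phi>D = test_functionsD[OF \<phi>]
  have "continuous_on {0..l} (\<lambda>x. vector_derivative \<phi> (at x))" "continuous_on {0..l} \<phi>"
    by (rule continuous_on_subset[OF \<phi>D(2)], simp) (rule continuous_on_subset[OF \<phi>D(3)], simp)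
  from this[THEN abs_int_mult_continuous[OF L2_on_imp_abs_int[OF y]]]
  show "(LINT x|lebesgue_on {0<..<l}. y x * vector_derivative \<phi> (at x)) =
      integral {0..l} (\<lambda>x. y x * vector_derivative \<phi> (at x))"
    "(LINT x|lebesgue_on {0<..<l}. y x * \<phi> x) = integral {0..l} (\<lambda>x. y x * \<phi> x)"
    by (auto intro!: LINT_Ioo_eq_integral simp: mult.commute)
qed

lemma has_weak_deriv_primitive:
  assumes l: "0 < l" and z: "primitive_on l z g" "L2_on {0<..<l} g"
    and ae: "AE x in lebesgue_on {0<..<l}. z x = y x"
  shows "has_weak_deriv l y g"
  unfolding has_weak_deriv_def
proof (intro conjI ballI)
  show y2: "L2_on {0<..<l} y"
    by (rule L2_on_cong_AE[OF L2_on_continuous[OF primitive_on_continuous[OF z(1)]] ae]) simp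
  show "L2_on {0<..<l} g" by fact
  fix \<phi> assume \<phi>: "\<phi> \<in> test_functions l"
  have "AE x in lebesgue_on {0<..<l}. y x * vector_derivative \<phi> (at x) = z x * vector_derivative \<phi> (at x)"
    using ae by eventually_elim simp
  then have "integral {0..l} (\<lambda>x. y x * vector_derivative \<phi> (at x)) =
      integral {0..l} (\<lambda>x. z x * vector_derivative \<phi> (at x))"
    by (rule integral_cong_AE_lebesgue_on) simp
  then show "(LINT x|lebesgue_on {0<..<l}. y x * vector_derivative \<phi> (at x)) =
        - (LINT x|lebesgue_on {0<..<l}. g x * \<phi> x)"
    using primitive_on_test_function[OF _ z(1) \<phi>] l
    by (simp add: test_function_pairing[OF y2 \<phi>] test_function_pairing[OF z(2) \<phi>])
qed

text \<open>With \<open>G\<close> a primitive of \<open>g\<close>, the difference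
  \<open>y - G\<close> is orthogonal to all derivatives of test functions, hence constant by du
  Bois-Reymond; shifting \<open>G\<close> by this constant \<open>C\<close> gives the
  representative.\<close>

lemma has_weak_derivE:
  assumes l: "0 < l" and "has_weak_deriv l y g"
  shows "\<exists>z. primitive_on l z g \<and> (AE x in lebesgue_on {0<..<l}. z x = y x)"
proof -
  have y: "L2_on {0<..<l} y" and g: "L2_on {0<..<l} g"
    and wd: "\<And>\<phi>. \<phi> \<in> test_functions l \<Longrightarrow>
        (LINT x|lebesgue_on {0<..<l}. y x * vector_derivative \<phi> (at x)) =
        - (LINT x|lebesgue_on {0<..<l}. g x * \<phi> x)"
    using assms unfolding has_weak_deriv_def by blast+
  have ga: "g absolutely_integrable_on {0..l}" and ya: "y absolutely_integrable_on {0..l}"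
    by (intro L2_on_imp_abs_int y g)+
  define G where "G x = 0 + integral {0..x} g" for x
  have G: "primitive_on l G g"
    unfolding G_def by (rule primitive_on_add_integral[OF ga])
  have Ga: "G absolutely_integrable_on {0..l}"
    by (rule absolutely_integrable_continuous_real[OF primitive_on_continuous[OF G]])
  define C where "C = integral {0..l} (\<lambda>x. y x - G x) / l"
  have "AE x in lebesgue_on {0..l}. y x - G x = C"
    unfolding C_def
  proof (rule du_Bois_Reymond[OF l])
    show "(\<lambda>x. y x - G x) absolutely_integrable_on {0..l}"
      by (intro set_integral_diff(1) ya Ga)
    fix \<phi> assume \<phi>: "\<phi> \<in> test_functions l"
    have c: "continuous_on {0..l} (\<lambda>x. vector_derivative \<phi> (at x))"
      by (rule continuous_on_subset[OF test_functionsD(2)[OF \<phi>]]) simp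
    have "integral {0..l} (\<lambda>x. y x * vector_derivative \<phi> (at x)) =
        integral {0..l} (\<lambda>x. G x * vector_derivative \<phi> (at x))"
      using wd[OF \<phi>] primitive_on_test_function[OF _ G \<phi>] l
      by (simp add: test_function_pairing[OF y \<phi>] test_function_pairing[OF g \<phi>])
    moreover have "(\<lambda>x. vector_derivative \<phi> (at x) * y x) integrable_on {0..l}"
      "(\<lambda>x. vector_derivative \<phi> (at x) * G x) integrable_on {0..l}"
      using abs_int_mult_continuous[OF ya c] abs_int_mult_continuous[OF Ga c]
      unfolding absolutely_integrable_on_def by blast+
    ultimately show "integral {0..l} (\<lambda>x. vector_derivative \<phi> (at x) * (y x - G x)) = 0"
      by (simp add: right_diff_distrib Henstock_Kurzweil_Integration.integral_diff mult.commute)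
  qed
  then have "AE x in lebesgue_on {0<..<l}. C + integral {0..x} g = y x"
    unfolding AE_Icc_iff_Ioo by (rule AE_mp, intro AE_I2) (auto simp: G_def)
  then show ?thesis
    using primitive_on_add_integral[OF ga] by blast
qed

lemma primitive_on_unique:
  assumes l: "0 < l" and z: "primitive_on l z g" and z': "primitive_on l z' g'"
    and ae: "AE x in lebesgue_on {0<..<l}. z x = z' x"
  shows "x \<in> {0..l} \<Longrightarrow> z x = z' x" and "AE x in lebesgue_on {0<..<l}. g x = g' x"
proof -
  show eq: "z x = z' x" if "x \<in> {0..l}" for x
    by (rule continuous_eq_if_AE_eq[OF l primitive_on_continuous[OF z] primitive_on_continuous[OF z'] ae that])
  note ga = primitive_onD(2)[OF z] primitive_onD(2)[OF z']
  have "AE x in lebesgue_on {0..l}. g x - g' x = 0"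
  proof (rule AE_zero_if_integral_zero)
    show "(\<lambda>x. g x - g' x) absolutely_integrable_on {0..l}"
      by (intro set_integral_diff(1) ga)
    fix x assume x: "x \<in> {0..l}"
    have "g integrable_on {0..x}" "g' integrable_on {0..x}"
      using ga[THEN absolutely_integrable_on_subinterval, of 0 x] x
      by (auto simp: absolutely_integrable_on_def)
    moreover have "integral {0..x} g = integral {0..x} g'"
      using primitive_onD(1)[OF z x] primitive_onD(1)[OF z' x] eq[OF x] eq[of 0] l by simp
    ultimately show "integral {0..x} (\<lambda>x. g x - g' x) = 0"
      by (simp add: Henstock_Kurzweil_Integration.integral_diff)
  qed (use l in simp)
  then show "AE x in lebesgue_on {0<..<l}. g x = g' x"
    unfolding AE_Icc_iff_Ioo by simp
qed

text \<open>\<open>SOME\<close> delivers just some weak derivative. It has a primitive that agrees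
  with \<open>z\<close> almost everywhere, so the integrands agree almost everywhere too. Every
  later fact about \<open>weak_deriv\<close> comes through here.\<close>

lemma weak_deriv_AE_eq:
  assumes l: "0 < l" and z: "primitive_on l z g" "L2_on {0<..<l} g"
    and ae: "AE x in lebesgue_on {0<..<l}. z x = y x"
  shows "AE x in lebesgue_on {0<..<l}. weak_deriv l y x = g x"
proof -
  have "has_weak_deriv l y (weak_deriv l y)"
    unfolding weak_deriv_def by (rule someI[of "has_weak_deriv l y", OF has_weak_deriv_primitive[OF assms]])
  then obtain z' where z': "primitive_on l z' (weak_deriv l y)" "AE x in lebesgue_on {0<..<l}. z' x = y x"
    using has_weak_derivE[OF l] by blast
  have "AE x in lebesgue_on {0<..<l}. z' x = z x"
    using ae z'(2) by eventually_elim simp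
  then show ?thesis by (rule primitive_on_unique(2)[OF l z'(1) z(1)])
qed

lemma W12_iff_primitive:
  assumes l: "0 < l"
  shows "y \<in> W12 l \<longleftrightarrow>
    (\<exists>z g. primitive_on l z g \<and> L2_on {0<..<l} g \<and> (AE x in lebesgue_on {0<..<l}. z x = y x))"
proof
  assume "y \<in> W12 l"
  then obtain g where g: "has_weak_deriv l y g" unfolding W12_def by blast
  then have "L2_on {0<..<l} g" unfolding has_weak_deriv_def by blast
  then show "\<exists>z g. primitive_on l z g \<and> L2_on {0<..<l} g \<and> (AE x in lebesgue_on {0<..<l}. z x = y x)"
    using has_weak_derivE[OF l g] by blast
qed (use has_weak_deriv_primitive[OF l] in \<open>unfold W12_def, blast\<close>)

lemma W12_continuous_primitive:
  assumes l: "0 < l" and y: "y \<in> W12 l" "continuous_on {0..l} y"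
  shows "\<exists>g. primitive_on l y g \<and> L2_on {0<..<l} g"
proof -
  obtain z g where z: "primitive_on l z g" "L2_on {0<..<l} g" "AE x in lebesgue_on {0<..<l}. z x = y x"
    using y(1) unfolding W12_iff_primitive[OF l] by blast
  have eq: "z x = y x" if "x \<in> {0..l}" for x
    by (rule continuous_eq_if_AE_eq[OF l primitive_on_continuous[OF z(1)] y(2) z(3) that])
  have "y x = y 0 + integral {0..x} g" if "x \<in> {0..l}" for x
    using primitive_onD(1)[OF z(1) that] eq[OF that] eq[of 0] l by simp
  then have "primitive_on l y g"
    unfolding primitive_on_def using primitive_onD(2)[OF z(1)] by blast
  then show ?thesis using z(2) by blast
qed

lemma cont_rep_eq:
  assumes l: "0 < l" and z: "continuous_on {0..l} z" "AE x in lebesgue_on {0<..<l}. z x = y x"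
    and x: "x \<in> {0..l}"
  shows "cont_rep l y x = z x"
proof -
  have "continuous_on {0..l} (cont_rep l y) \<and> (AE x in lebesgue_on {0<..<l}. cont_rep l y x = y x)"
    unfolding cont_rep_def by (rule someI[where x = z]) (use z in blast)
  then have c: "continuous_on {0..l} (cont_rep l y)" "AE x in lebesgue_on {0<..<l}. cont_rep l y x = y x"
    by blast+
  have "AE x in lebesgue_on {0<..<l}. cont_rep l y x = z x"
    using c(2) z(2) by eventually_elim simp
  then show ?thesis by (rule continuous_eq_if_AE_eq[OF l c(1) z(1) _ x])
qed

section \<open>Volterra systems\<close>

text \<open>The bound keeps its shape because \<open>M\<close> times its n-th instance has the
  (n+1)-st as antiderivative vanishing at 0. The factorial gained per integration drives both
  uniqueness and the convergence of the series.\<close>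

lemma norm_integral_power_bound:
  fixes a w :: "real \<Rightarrow> complex"
  assumes c: "continuous_on {0..l} a" "continuous_on {0..l} w"
    and a: "\<And>t. t \<in> {0..l} \<Longrightarrow> norm (a t) \<le> M"
    and w: "\<And>t. t \<in> {0..l} \<Longrightarrow> norm (w t) \<le> B * (M * t) ^ n / fact n"
    and x: "x \<in> {0..l}"
  shows "norm (integral {0..x} (\<lambda>t. a t * w t)) \<le> B * (M * x) ^ Suc n / fact (Suc n)"
proof -
  have "((\<lambda>t. M * (B * (M * t) ^ n / fact n)) has_integral
      B * (M * x) ^ Suc n / fact (Suc n) - B * (M * 0) ^ Suc n / fact (Suc n)) {0..x}"
  proof (rule fundamental_theorem_of_calculus)
    fix t
    have "((\<lambda>t. B * (M * t) ^ Suc n / fact (Suc n)) has_real_derivative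
        B * (real (Suc n) * (M * t) ^ n * M) / fact (Suc n)) (at t within {0..x})"
      by (rule derivative_eq_intros refl | simp)+
    moreover have "B * (real (Suc n) * (M * t) ^ n * M) / fact (Suc n) = M * (B * (M * t) ^ n / fact n)"
      by (simp add: field_simps del: of_nat_Suc)
    ultimately show "((\<lambda>t. B * (M * t) ^ Suc n / fact (Suc n)) has_vector_derivative
        M * (B * (M * t) ^ n / fact n)) (at t within {0..x})"
      by (simp only: has_real_derivative_iff_has_vector_derivative)
  qed (use x in simp)
  then have hi: "((\<lambda>t. M * (B * (M * t) ^ n / fact n)) has_integral B * (M * x) ^ Suc n / fact (Suc n)) {0..x}"
    by simp
  have "norm (integral {0..x} (\<lambda>t. a t * w t)) \<le> integral {0..x} (\<lambda>t. M * (B * (M * t) ^ n / fact n))"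
  proof (rule integral_norm_bound_integral)
    show "(\<lambda>t. a t * w t) integrable_on {0..x}"
      by (intro integrable_continuous_real continuous_intros continuous_on_subset[OF c(1)]
          continuous_on_subset[OF c(2)]) (use x in auto)
    show "(\<lambda>t. M * (B * (M * t) ^ n / fact n)) integrable_on {0..x}"
      using hi by (rule has_integral_integrable)
    fix t assume "t \<in> {0..x}"
    then have t: "t \<in> {0..l}" using x by auto
    show "norm (a t * w t) \<le> M * (B * (M * t) ^ n / fact n)"
      unfolding norm_mult
      by (intro mult_mono a[OF t] w[OF t] norm_ge_zero order_trans[OF norm_ge_zero a[OF t]])
  qed
  then show ?thesis using integral_unique[OF hi] by simp
qed

text \<open>The two equations are inserted into each other repeatedly. Each unknown controls the
  next step of the other, so both are bounded in one induction with common constants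
  \<open>B\<close> and \<open>M\<close>; the bounds are multiples of the terms of an exponential
  series and tend to 0.\<close>

lemma homogeneous_Volterra_zero:
  fixes p q u w :: "real \<Rightarrow> complex"
  assumes c: "continuous_on {0..l} p" "continuous_on {0..l} q" "continuous_on {0..l} u" "continuous_on {0..l} w"
    and u: "\<And>x. x \<in> {0..l} \<Longrightarrow> u x = integral {0..x} (\<lambda>t. p t * w t)"
    and w: "\<And>x. x \<in> {0..l} \<Longrightarrow> w x = integral {0..x} (\<lambda>t. q t * u t)"
    and x: "x \<in> {0..l}"
  shows "u x = 0" "w x = 0"
proof -
  have ex: "\<exists>M. \<forall>t\<in>{0..l}. norm (a t) \<le> M" if "continuous_on {0..l} a" for a :: "real \<Rightarrow> complex"
    using compact_imp_bounded[OF compact_continuous_image[OF that compact_Icc]]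
    unfolding bounded_iff by blast
  obtain Mp where Mp: "\<And>t. t \<in> {0..l} \<Longrightarrow> norm (p t) \<le> Mp" using ex[OF c(1)] by blast
  obtain Mq where Mq: "\<And>t. t \<in> {0..l} \<Longrightarrow> norm (q t) \<le> Mq" using ex[OF c(2)] by blast
  obtain Bu where Bu: "\<And>t. t \<in> {0..l} \<Longrightarrow> norm (u t) \<le> Bu" using ex[OF c(3)] by blast
  obtain Bw where Bw: "\<And>t. t \<in> {0..l} \<Longrightarrow> norm (w t) \<le> Bw" using ex[OF c(4)] by blast
  define M where "M = max Mp Mq"
  define B where "B = max Bu Bw"
  have M: "norm (p t) \<le> M" "norm (q t) \<le> M" if "t \<in> {0..l}" for t
    using Mp[OF that] Mq[OF that] by (auto simp: M_def)
  have "(\<forall>t\<in>{0..l}. norm (u t) \<le> B * (M * t) ^ n / fact n) \<and>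
        (\<forall>t\<in>{0..l}. norm (w t) \<le> B * (M * t) ^ n / fact n)" for n
  proof (induction n)
    case 0
    then show ?case using Bu Bw by (auto simp: B_def le_max_iff_disj)
  next
    case (Suc n)
    have "norm (u t) \<le> B * (M * t) ^ Suc n / fact (Suc n)" if "t \<in> {0..l}" for t
      unfolding u[OF that]
      by (rule norm_integral_power_bound[OF c(1,4) M(1) _ that]) (use Suc in blast)+
    moreover have "norm (w t) \<le> B * (M * t) ^ Suc n / fact (Suc n)" if "t \<in> {0..l}" for t
      unfolding w[OF that]
      by (rule norm_integral_power_bound[OF c(2,3) M(2) _ that]) (use Suc in blast)+
    ultimately show ?case by blast
  qed
  then have bd: "norm (u x) \<le> B * (M * x) ^ n / fact n" "norm (w x) \<le> B * (M * x) ^ n / fact n" for n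
    using x by blast+
  have "(\<lambda>n. B * (inverse (fact n) * (M * x) ^ n)) \<longlonglongrightarrow> B * 0"
    by (intro tendsto_intros summable_LIMSEQ_zero summable_exp)
  then have lim: "(\<lambda>n. B * (M * x) ^ n / fact n) \<longlonglongrightarrow> 0"
    by (simp add: field_simps)
  have "norm (u x) \<le> 0" "norm (w x) \<le> 0"
    by (rule LIMSEQ_le_const[OF lim], use bd in blast)+
  then show "u x = 0" "w x = 0" by auto
qed

section \<open>Picard iterates and their power series\<close>

text \<open>The weights trade places at every step, so the nested integrals carry \<open>p\<close>,
  \<open>q\<close>, \<open>p\<close>, ... from the outside inwards. One family thus serves both
  unknowns of a coupled system: one has \<open>p\<close> as its outermost weight, the other
  \<open>q\<close>.\<close>

fun Volterra_iterate :: "(real \<Rightarrow> complex) \<Rightarrow> (real \<Rightarrow> complex) \<Rightarrow> nat \<Rightarrow> real \<Rightarrow> complex" where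
  "Volterra_iterate p q 0 x = 1"
| "Volterra_iterate p q (Suc n) x = integral {0..x} (\<lambda>t. p t * Volterra_iterate q p n t)"

lemma continuous_on_indefinite_integral:
  fixes h :: "real \<Rightarrow> complex"
  assumes "continuous_on {0..l} h"
  shows "continuous_on {0..l} (\<lambda>x. integral {0..x} h)"
  by (intro indefinite_integral_continuous_1 integrable_continuous_real assms)

lemma continuous_on_Volterra_iterate:
  assumes "continuous_on {0..l} p" "continuous_on {0..l} q"
  shows "continuous_on {0..l} (Volterra_iterate p q n)"
  using assms
proof (induction n arbitrary: p q)
  case 0
  show ?case unfolding Volterra_iterate.simps by (rule continuous_on_const)
next
  case (Suc n)
  show ?case unfolding Volterra_iterate.simps
    by (intro continuous_on_indefinite_integral continuous_on_mult Suc)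
qed

lemma norm_Volterra_iterate_le:
  assumes "continuous_on {0..l} p" "continuous_on {0..l} q"
    and "\<And>t. t \<in> {0..l} \<Longrightarrow> norm (p t) \<le> M" "\<And>t. t \<in> {0..l} \<Longrightarrow> norm (q t) \<le> M" and "x \<in> {0..l}"
  shows "norm (Volterra_iterate p q n x) \<le> (M * x) ^ n / fact n"
  using assms
proof (induction n arbitrary: p q x)
  case (Suc n)
  have "norm (Volterra_iterate p q (Suc n) x) \<le> 1 * (M * x) ^ Suc n / fact (Suc n)"
    unfolding Volterra_iterate.simps
    by (rule norm_integral_power_bound[OF Suc.prems(1) continuous_on_Volterra_iterate[OF Suc.prems(2,1)] Suc.prems(3) _ Suc.prems(5)])
       (use Suc in auto)
  then show ?case by simp
qed simp

definition Volterra_series :: "(real \<Rightarrow> complex) \<Rightarrow> (real \<Rightarrow> complex) \<Rightarrow> complex \<Rightarrow> real \<Rightarrow> complex" where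
  "Volterra_series p q s x = (\<Sum>k. s ^ k * Volterra_iterate p q k x)"

text \<open>The factorial decay of the iterates gives an exponential majorant for every complex
  \<open>s\<close>, and the Weierstrass test applies.\<close>

lemma Volterra_series_uniform_limit:
  assumes c: "continuous_on {0..l} p" "continuous_on {0..l} q"
  shows "uniform_limit {0..l} (\<lambda>n x. \<Sum>k<n. s ^ k * Volterra_iterate p q k x) (Volterra_series p q s) sequentially"
    and "x \<in> {0..l} \<Longrightarrow> summable (\<lambda>k. s ^ k * Volterra_iterate p q k x)"
    and "continuous_on {0..l} (Volterra_series p q s)"
proof -
  have ex: "\<exists>M. \<forall>t\<in>{0..l}. norm (a t) \<le> M" if "continuous_on {0..l} a" for a :: "real \<Rightarrow> complex"
    using compact_imp_bounded[OF compact_continuous_image[OF that compact_Icc]]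
    unfolding bounded_iff by blast
  obtain Mp where Mp: "\<And>t. t \<in> {0..l} \<Longrightarrow> norm (p t) \<le> Mp" using ex[OF c(1)] by blast
  obtain Mq where Mq: "\<And>t. t \<in> {0..l} \<Longrightarrow> norm (q t) \<le> Mq" using ex[OF c(2)] by blast
  define M where "M = max 0 (max Mp Mq)"
  have M: "norm (p t) \<le> M" "norm (q t) \<le> M" if "t \<in> {0..l}" for t
    using Mp[OF that] Mq[OF that] by (auto simp: M_def)
  have M0: "0 \<le> M" by (simp add: M_def)
  have bd: "norm (s ^ k * Volterra_iterate p q k x) \<le> inverse (fact k) * (norm s * (M * l)) ^ k"
    if x: "x \<in> {0..l}" for k x
  proof -
    have "norm (Volterra_iterate p q k x) \<le> (M * x) ^ k / fact k"
      by (rule norm_Volterra_iterate_le[OF c M x])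
    also have "\<dots> \<le> (M * l) ^ k / fact k"
      using x M0 by (intro divide_right_mono power_mono mult_left_mono) auto
    finally have "norm s ^ k * norm (Volterra_iterate p q k x) \<le> norm s ^ k * ((M * l) ^ k / fact k)"
      by (intro mult_left_mono) auto
    then show ?thesis by (simp add: norm_mult norm_power power_mult_distrib field_simps)
  qed
  show ul: "uniform_limit {0..l} (\<lambda>n x. \<Sum>k<n. s ^ k * Volterra_iterate p q k x) (Volterra_series p q s) sequentially"
    unfolding Volterra_series_def by (rule Weierstrass_m_test[OF bd summable_exp])
  show "summable (\<lambda>k. s ^ k * Volterra_iterate p q k x)" if "x \<in> {0..l}"
    by (rule summable_comparison_test'[OF summable_exp bd[OF that]])
  show "continuous_on {0..l} (Volterra_series p q s)"
    by (rule uniform_limit_theorem[OF _ ul])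
       (auto intro!: always_eventually continuous_intros continuous_on_Volterra_iterate c)
qed

text \<open>The series with swapped weights is integrated term by term, which uniform convergence
  permits. Together with the instance in which \<open>p\<close> and \<open>q\<close> are exchanged
  this is the coupled system.\<close>

lemma Volterra_series_eq:
  assumes c: "continuous_on {0..l} p" "continuous_on {0..l} q" and x: "x \<in> {0..l}"
  shows "Volterra_series p q s x = 1 + s * integral {0..x} (\<lambda>t. p t * Volterra_series q p s t)"
proof -
  let ?V = "Volterra_iterate"
  have sub: "{0..x} \<subseteq> {0..l}" using x by auto
  have cx: "continuous_on {0..x} p" "continuous_on {0..x} (?V q p k)"
    "continuous_on {0..x} (Volterra_series q p s)" for k
    using c sub by (auto intro: continuous_on_subset continuous_on_Volterra_iterate Volterra_series_uniform_limit(3))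
  have "uniform_limit {0..x} (\<lambda>n t. \<Sum>k<n. s ^ k * ?V q p k t) (Volterra_series q p s) sequentially"
    by (rule uniform_limit_on_subset[OF Volterra_series_uniform_limit(1)[OF c(2,1)] sub])
  then have ul: "uniform_limit {0..x} (\<lambda>n t. p t * (\<Sum>k<n. s ^ k * ?V q p k t))
      (\<lambda>t. p t * Volterra_series q p s t) sequentially"
    by (rule uniform_lim_mult[OF uniform_limit_const])
       (intro compact_imp_bounded compact_continuous_image cx compact_Icc)+
  have ct: "continuous_on {0..x} (\<lambda>t. p t * (\<Sum>k<n. s ^ k * ?V q p k t))" for n
    by (intro continuous_intros cx)
  define I where "I n = integral {0..x} (\<lambda>t. p t * (\<Sum>k<n. s ^ k * ?V q p k t))" for n
  define J where "J = integral {0..x} (\<lambda>t. p t * Volterra_series q p s t)"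
  have IJ: "I \<longlonglongrightarrow> J"
  proof (rule uniform_limit_integral[OF ul ct trivial_limit_sequentially])
    fix I' J'
    assume I': "\<And>n. ((\<lambda>t. p t * (\<Sum>k<n. s ^ k * ?V q p k t)) has_integral I' n) {0..x}"
      and J': "((\<lambda>t. p t * Volterra_series q p s t) has_integral J') {0..x}" and lim: "I' \<longlonglongrightarrow> J'"
    have "I = I'" unfolding I_def by (rule ext) (rule integral_unique[OF I'])
    moreover have "J = J'" unfolding J_def by (rule integral_unique[OF J'])
    ultimately show "I \<longlonglongrightarrow> J" using lim by simp
  qed
  \<comment> \<open>Index 0 contributes the initial value 1. Integrating against \<open>p\<close>
    and multiplying by \<open>s\<close> moves index \<open>k\<close> to \<open>k + 1\<close>, hence
    \<open>n\<close> terms inside \<open>I n\<close> and \<open>Suc n\<close> terms on the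
    right.\<close>
  have "1 + s * I n = (\<Sum>k<Suc n. s ^ k * ?V p q k x)" for n
  proof -
    have "I n = integral {0..x} (\<lambda>t. \<Sum>k<n. s ^ k * (p t * ?V q p k t))"
      unfolding I_def by (simp add: sum_distrib_left mult.left_commute)
    also have "\<dots> = (\<Sum>k<n. s ^ k * ?V p q (Suc k) x)"
      by (subst Henstock_Kurzweil_Integration.integral_sum)
         (auto intro!: integrable_continuous_real continuous_intros cx)
    finally show ?thesis
      by (simp add: sum.lessThan_Suc_shift sum_distrib_left mult.assoc del: Volterra_iterate.simps(2) sum.lessThan_Suc)
  qed
  moreover have "(\<lambda>n. \<Sum>k<Suc n. s ^ k * ?V p q k x) \<longlonglongrightarrow> Volterra_series p q s x"
    using LIMSEQ_Suc[OF summable_LIMSEQ[OF Volterra_series_uniform_limit(2)[OF c x]]]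
    unfolding Volterra_series_def .
  moreover have "(\<lambda>n. 1 + s * I n) \<longlonglongrightarrow> 1 + s * J"
    by (intro tendsto_intros IJ)
  ultimately have "Volterra_series p q s x = 1 + s * J"
    using LIMSEQ_unique by (metis (no_types, lifting) ext)
  then show ?thesis unfolding J_def .
qed

section \<open>Formal powers as Picard iterates\<close>

lemma LINT_Icc_continuous:
  fixes h :: "real \<Rightarrow> complex"
  assumes "continuous_on {a..b} h"
  shows "(LINT x|lebesgue_on {a..b}. h x) = integral {a..b} h"
  using lebesgue_integral_eq_integral[OF continuous_imp_integrable_real[OF assms]] by simp

text \<open>Two steps of the iteration make one step of the recursion for formal powers. The inner
  factor \<open>f\<close> meets the \<open>f\<close> in front of the previous power and forms
  \<open>(f t)\<^sup>2\<close>; the product of two consecutive integers is absorbed by the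
  factorial.\<close>

lemma formal_power_eq_Volterra_iterate:
  assumes f: "continuous_on {0..l} f" "\<And>t. t \<in> {0..l} \<Longrightarrow> f t \<noteq> 0" and x: "x \<in> {0..l}"
  shows "formal_power f k x = fact k * f x * Volterra_iterate (\<lambda>t. 1 / (f t)\<^sup>2) (\<lambda>t. (f t)\<^sup>2) k x"
  using x
proof (induction k arbitrary: x rule: induct_nat_012)
  case 1
  have "continuous_on {0..x} (\<lambda>t. 1 / (f t)\<^sup>2)"
    using f(2) 1 by (intro continuous_intros continuous_on_subset[OF f(1)]) auto
  then show ?case by (simp add: LINT_Icc_continuous)
next
  case (ge2 k)
  let ?p = "\<lambda>t. 1 / (f t)\<^sup>2" and ?q = "\<lambda>t. (f t)\<^sup>2"
  let ?V = "Volterra_iterate"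
  have cp: "continuous_on {0..l} ?p" and cq: "continuous_on {0..l} ?q"
    using f by (auto intro!: continuous_intros)
  \<comment> \<open>After the first of the two steps the outermost weight is the square of
    \<open>f\<close>, hence the swapped arguments of \<open>?V\<close>.\<close>
  have inner: "(LINT s|lebesgue_on {0..t}. f s * formal_power f k s) = fact k * ?V ?q ?p (Suc k) t"
    if t: "t \<in> {0..l}" for t
  proof -
    have "(LINT s|lebesgue_on {0..t}. f s * formal_power f k s) =
        (LINT s|lebesgue_on {0..t}. fact k * (?q s * ?V ?p ?q k s))"
    proof (rule Bochner_Integration.integral_cong[OF refl])
      fix s assume "s \<in> space (lebesgue_on {0..t})"
      then have "s \<in> {0..l}" using t by auto
      from ge2.IH(1)[OF this] show "f s * formal_power f k s = fact k * (?q s * ?V ?p ?q k s)"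
        by (simp add: power2_eq_square)
    qed
    also have "\<dots> = integral {0..t} (\<lambda>s. fact k * (?q s * ?V ?p ?q k s))"
    proof (rule LINT_Icc_continuous)
      show "continuous_on {0..t} (\<lambda>s. fact k * (?q s * ?V ?p ?q k s))"
        by (rule continuous_on_subset[of "{0..l}"])
           (use t in \<open>auto intro!: continuous_intros continuous_on_Volterra_iterate cp f\<close>)
    qed
    finally show ?thesis by simp
  qed
  have "(LINT t|lebesgue_on {0..x}. 1 / (f t)\<^sup>2 * (LINT s|lebesgue_on {0..t}. f s * formal_power f k s)) =
      (LINT t|lebesgue_on {0..x}. fact k * (?p t * ?V ?q ?p (Suc k) t))"
  proof (rule Bochner_Integration.integral_cong[OF refl])
    fix t assume "t \<in> space (lebesgue_on {0..x})"
    then have "t \<in> {0..l}" using ge2.prems by auto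
    from inner[OF this] show "1 / (f t)\<^sup>2 * (LINT s|lebesgue_on {0..t}. f s * formal_power f k s) =
        fact k * (?p t * ?V ?q ?p (Suc k) t)" by simp
  qed
  also have "\<dots> = integral {0..x} (\<lambda>t. fact k * (?p t * ?V ?q ?p (Suc k) t))"
  proof (rule LINT_Icc_continuous)
    have "continuous_on {0..l} (\<lambda>t. fact k * (?p t * ?V ?q ?p (Suc k) t))"
      by (intro continuous_on_mult continuous_on_const continuous_on_Volterra_iterate cp cq)
    then show "continuous_on {0..x} (\<lambda>t. fact k * (?p t * ?V ?q ?p (Suc k) t))"
      by (rule continuous_on_subset) (use ge2.prems in auto)
  qed
  also have "\<dots> = fact k * ?V ?p ?q (Suc (Suc k)) x"
    by (simp only: Volterra_iterate.simps Henstock_Kurzweil_Integration.integral_mult_right)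
  finally have "(LINT t|lebesgue_on {0..x}. 1 / (f t)\<^sup>2 * (LINT s|lebesgue_on {0..t}. f s * formal_power f k s)) =
      fact k * ?V ?p ?q (Suc (Suc k)) x" .
  then show ?case
    unfolding formal_power.simps fact_Suc by (simp del: Volterra_iterate.simps)
qed simp

section \<open>The Schroedinger equation\<close>

locale nonvanishing_W12 =
  fixes l :: real and f :: "real \<Rightarrow> complex"
  assumes l: "0 < l" and f_W12: "f \<in> W12 l" and f_cont: "continuous_on {0..l} f"
    and f_nz: "\<And>x. x \<in> {0..l} \<Longrightarrow> f x \<noteq> 0" and f_0: "f 0 = 1"
begin

abbreviation "p \<equiv> \<lambda>t. 1 / (f t)\<^sup>2"
abbreviation "q \<equiv> \<lambda>t. (f t)\<^sup>2"

lemma p_cont: "continuous_on {0..l} p" and q_cont: "continuous_on {0..l} q"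
  using f_nz by (auto intro!: continuous_intros f_cont)

text \<open>The continuous representative of a \<open>W12\<close> class together with a concrete
  weak derivative, free of \<open>SOME\<close>.\<close>

definition primitive_L2 :: "(real \<Rightarrow> complex) \<Rightarrow> (real \<Rightarrow> complex) \<Rightarrow> bool" where
  "primitive_L2 y g \<longleftrightarrow> primitive_on l y g \<and> L2_on {0<..<l} g"

lemma primitive_L2_mult:
  assumes "primitive_L2 y g" "primitive_L2 z h"
  shows "primitive_L2 (\<lambda>x. y x * z x) (\<lambda>x. y x * h x + z x * g x)"
proof -
  have y: "primitive_on l y g" "L2_on {0<..<l} g" and z: "primitive_on l z h" "L2_on {0<..<l} h"
    using assms unfolding primitive_L2_def by blast+
  show ?thesis
    unfolding primitive_L2_def
    by (intro conjI primitive_on_mult L2_on_add L2_on_mult_continuous y z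
        primitive_on_continuous[OF y(1)] primitive_on_continuous[OF z(1)])
qed

lemma primitive_L2_AE:
  assumes "primitive_L2 z g" "\<And>x. x \<in> {0<..<l} \<Longrightarrow> z x = y x"
  shows "y \<in> W12 l" "AE x in lebesgue_on {0<..<l}. weak_deriv l y x = g x"
proof -
  have ae: "AE x in lebesgue_on {0<..<l}. z x = y x" using assms(2) by (intro AE_I2) simp
  show "y \<in> W12 l" using assms(1) ae W12_iff_primitive[OF l] unfolding primitive_L2_def by blast
  show "AE x in lebesgue_on {0<..<l}. weak_deriv l y x = g x"
    using weak_deriv_AE_eq[OF l _ _ ae] assms(1) unfolding primitive_L2_def by blast
qed

lemma f_primitive: "\<exists>g. primitive_L2 f g"
  unfolding primitive_L2_def by (rule W12_continuous_primitive[OF l f_W12 f_cont])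

lemma inverse_f_primitive: "\<exists>g. primitive_L2 (\<lambda>x. 1 / f x) g"
proof -
  obtain g where g: "primitive_on l f g" "L2_on {0<..<l} g"
    using f_primitive unfolding primitive_L2_def by blast
  have "L2_on {0<..<l} (\<lambda>x. - p x * g x)"
    by (intro L2_on_mult_continuous g continuous_on_minus p_cont)
  then show ?thesis
    unfolding primitive_L2_def using primitive_on_inverse[OF g(1) f_nz] by (intro exI conjI) auto
qed

lemma primitive_L2_of_integral:
  assumes "continuous_on {0..l} h" "\<And>x. x \<in> {0..l} \<Longrightarrow> y x = c + integral {0..x} h"
  shows "primitive_L2 y h"
proof -
  have "y x = y 0 + integral {0..x} h" if "x \<in> {0..l}" for x
    using assms(2)[OF that] assms(2)[of 0] l by simp
  then show ?thesis
    unfolding primitive_L2_def primitive_on_def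
    using absolutely_integrable_continuous_real[OF assms(1)] L2_on_continuous[OF assms(1)] by blast
qed

text \<open>The predicate under the definite description in \<open>ef\<close>, named so that
  existence and uniqueness can be stated.\<close>

definition is_ef :: "complex \<Rightarrow> (real \<Rightarrow> complex) \<Rightarrow> bool" where
  "is_ef \<rho> y \<longleftrightarrow> continuous_on {0..l} y \<and> (\<forall>x. x \<notin> {0..l} \<longrightarrow> y x = 0) \<and>
     y \<in> Sdom l f \<and>
     (AE x in lebesgue_on {0<..<l}. Sop l f y x = \<rho>\<^sup>2 * y x) \<and>
     y 0 = 1 \<and> cont_rep l (Dop l f y) 0 = \<i> * \<rho>"

text \<open>
  Writing \<open>y = f u\<close> and \<open>D\<^sub>f y = w / f\<close>, the equation \<open>S\<^sub>f y = \<rho>\<^sup>2 y\<close> with its initial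
  conditions becomes the Volterra system \<open>u = 1 + \<integral>w/f\<^sup>2\<close>, \<open>w = \<i>\<rho> + (\<i>\<rho>)\<^sup>2 \<integral>f\<^sup>2 u\<close>, whose
  coefficients are continuous.
\<close>

definition u :: "complex \<Rightarrow> real \<Rightarrow> complex" where
  "u \<rho> = Volterra_series p q (\<i> * \<rho>)"

definition w :: "complex \<Rightarrow> real \<Rightarrow> complex" where
  "w \<rho> x = \<i> * \<rho> * Volterra_series q p (\<i> * \<rho>) x"

lemma u_cont: "continuous_on {0..l} (u \<rho>)"
  unfolding u_def by (rule Volterra_series_uniform_limit(3)[OF p_cont q_cont])

lemma w_cont: "continuous_on {0..l} (w \<rho>)"
  unfolding w_def
  by (intro continuous_on_mult continuous_on_const Volterra_series_uniform_limit(3) p_cont q_cont)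

lemma u_eq:
  assumes "x \<in> {0..l}"
  shows "u \<rho> x = 1 + integral {0..x} (\<lambda>t. p t * w \<rho> t)"
  using Volterra_series_eq[OF p_cont q_cont assms, of "\<i> * \<rho>"]
  by (simp add: u_def w_def mult.left_commute[of "1 / _"] mult.left_commute[of "\<i> * \<rho>"]
      flip: Henstock_Kurzweil_Integration.integral_mult_right)

lemma w_eq:
  assumes "x \<in> {0..l}"
  shows "w \<rho> x = \<i> * \<rho> + integral {0..x} (\<lambda>t. (\<i> * \<rho>)\<^sup>2 * q t * u \<rho> t)"
proof -
  have "w \<rho> x = \<i> * \<rho> * (1 + \<i> * \<rho> * integral {0..x} (\<lambda>t. q t * u \<rho> t))"
    unfolding w_def u_def Volterra_series_eq[OF q_cont p_cont assms, of "\<i> * \<rho>"] ..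
  also have "\<dots> = \<i> * \<rho> + (\<i> * \<rho>)\<^sup>2 * integral {0..x} (\<lambda>t. q t * u \<rho> t)"
    by (simp add: algebra_simps power2_eq_square)
  finally show ?thesis
    by (simp only: mult.assoc Henstock_Kurzweil_Integration.integral_mult_right)
qed

text \<open>The quotients under the two weak derivatives are exactly \<open>u\<close> and
  \<open>w\<close>: y / f = u has quasi-derivative w / f, and (w / f) / (1 / f) = w leads to
  \<open>(\<i> * \<rho>)\<^sup>2 * f * u\<close>, where the square of \<open>\<i>\<close> matches
  the minus sign in \<open>Sop\<close>. The derivatives of \<open>f\<close> and \<open>1 / f\<close>
  enter only through the regularity of \<open>y\<close> and of its quasi-derivative.\<close>

lemma is_ef_series: "is_ef \<rho> (\<lambda>x. if x \<in> {0..l} then f x * u \<rho> x else 0)"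
proof -
  define y where "y x = (if x \<in> {0..l} then f x * u \<rho> x else 0)" for x
  define D where "D = Dop l f y"
  have y: "y x = f x * u \<rho> x" if "x \<in> {0..l}" for x using that by (simp add: y_def)
  have u: "primitive_L2 (u \<rho>) (\<lambda>t. p t * w \<rho> t)"
    by (rule primitive_L2_of_integral[OF _ u_eq]) (intro continuous_on_mult p_cont w_cont)
  have w: "primitive_L2 (w \<rho>) (\<lambda>t. (\<i> * \<rho>)\<^sup>2 * q t * u \<rho> t)"
    by (rule primitive_L2_of_integral[OF _ w_eq])
       (intro continuous_on_mult continuous_on_const q_cont u_cont)
  obtain g where g: "primitive_L2 f g" using f_primitive by blast
  obtain gi where gi: "primitive_L2 (\<lambda>x. 1 / f x) gi" using inverse_f_primitive by blast
  have yc: "continuous_on {0..l} y"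
    by (rule continuous_on_eq[of _ "\<lambda>x. f x * u \<rho> x"]) (auto intro: continuous_intros f_cont u_cont simp: y)
  have yW: "y \<in> W12 l"
    by (rule primitive_L2_AE(1)[OF primitive_L2_mult[OF g u]]) (simp add: y)
  have "AE x in lebesgue_on {0<..<l}. weak_deriv l (\<lambda>s. y s / f s) x = p x * w \<rho> x"
    by (rule primitive_L2_AE(2)[OF u]) (simp add: y f_nz)
  then have DAE: "AE x in lebesgue_on {0<..<l}. w \<rho> x * (1 / f x) = D x"
    by (rule AE_mp, intro AE_I2) (auto simp: D_def Dop_def f_nz power2_eq_square)
  have wf: "primitive_L2 (\<lambda>x. w \<rho> x * (1 / f x))
      (\<lambda>x. w \<rho> x * gi x + 1 / f x * ((\<i> * \<rho>)\<^sup>2 * q x * u \<rho> x))"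
    by (rule primitive_L2_mult[OF w gi])
  then have DW: "D \<in> W12 l"
    unfolding W12_iff_primitive[OF l] primitive_L2_def using DAE by blast
  have "cont_rep l D 0 = w \<rho> 0 * (1 / f 0)"
    by (rule cont_rep_eq[OF l _ DAE]) (use wf l in \<open>auto simp: primitive_L2_def intro: primitive_on_continuous\<close>)
  \<comment> \<open>Since \<open>f 0 = 1\<close>, the initial values of w / f and w
    coincide.\<close>
  then have D0: "cont_rep l D 0 = \<i> * \<rho>"
    using w_eq[of 0 \<rho>] l by (simp add: f_0)
  have wD: "AE x in lebesgue_on {0<..<l}. w \<rho> x = D x / (1 / f x)"
    using DAE by (rule AE_mp, intro AE_I2 impI) (simp add: f_nz flip: nonzero_divide_eq_eq)
  have "AE x in lebesgue_on {0<..<l}. weak_deriv l (\<lambda>s. D s / (1 / f s)) x = (\<i> * \<rho>)\<^sup>2 * q x * u \<rho> x"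
    by (rule weak_deriv_AE_eq[OF l _ _ wD]) (use w in \<open>unfold primitive_L2_def, blast+\<close>)
  then have S: "AE x in lebesgue_on {0<..<l}. Sop l f y x = \<rho>\<^sup>2 * y x"
  proof (rule AE_mp, intro AE_I2 impI)
    fix x assume x: "x \<in> space (lebesgue_on {0<..<l})"
      and wd: "weak_deriv l (\<lambda>s. D s / (1 / f s)) x = (\<i> * \<rho>)\<^sup>2 * q x * u \<rho> x"
    have "Sop l f y x = - (1 / f x * ((\<i> * \<rho>)\<^sup>2 * q x * u \<rho> x))"
      unfolding Sop_def Dop_def[of l "\<lambda>s. 1 / f s"] D_def[symmetric] wd ..
    also have "\<dots> = \<rho>\<^sup>2 * (f x * u \<rho> x)"
      using x f_nz[of x] by (simp add: power_mult_distrib) (simp add: power2_eq_square)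
    finally show "Sop l f y x = \<rho>\<^sup>2 * y x" using x by (simp add: y)
  qed
  have y0: "y 0 = 1"
    using u_eq[of 0 \<rho>] l by (simp add: y f_0)
  have "is_ef \<rho> y"
    unfolding is_ef_def Sdom_def using yc yW DW D0 S y0 by (auto simp: D_def y_def)
  then show ?thesis unfolding y_def .
qed

text \<open>Any solution yields a pair \<open>u1\<close>, \<open>w1\<close>, absolutely continuous
  by the product rule, whose derivatives are read off from the equation almost everywhere. After
  integration the pair satisfies the Volterra system at every point, and its difference from
  \<open>u\<close>, \<open>w\<close> solves the homogeneous system.\<close>

lemma is_ef_unique:
  assumes "is_ef \<rho> y"
  shows "y = (\<lambda>x. if x \<in> {0..l} then f x * u \<rho> x else 0)"
proof -
  define D where "D = Dop l f y"
  have yc: "continuous_on {0..l} y" and yout: "\<And>x. x \<notin> {0..l} \<Longrightarrow> y x = 0"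
    and yW: "y \<in> W12 l" and DW: "D \<in> W12 l"
    and S: "AE x in lebesgue_on {0<..<l}. Sop l f y x = \<rho>\<^sup>2 * y x"
    and y0: "y 0 = 1" and D0: "cont_rep l D 0 = \<i> * \<rho>"
    using assms unfolding is_ef_def Sdom_def D_def by auto
  obtain gi where gi: "primitive_L2 (\<lambda>x. 1 / f x) gi" using inverse_f_primitive by blast
  obtain g where g: "primitive_L2 f g" using f_primitive by blast
  obtain gy where gy: "primitive_L2 y gy"
    using W12_continuous_primitive[OF l yW yc] unfolding primitive_L2_def by blast
  define u1 where "u1 x = y x * (1 / f x)" for x
  obtain g1 where g1: "primitive_L2 u1 g1"
    using primitive_L2_mult[OF gy gi] unfolding u1_def by blast
  have Dg1: "AE x in lebesgue_on {0<..<l}. weak_deriv l (\<lambda>s. y s / f s) x = g1 x"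
    by (rule primitive_L2_AE(2)[OF g1]) (simp add: u1_def)
  \<comment> \<open>\<open>D\<close> is fixed only up to null sets; its continuous representative
    \<open>z\<close> carries the initial value.\<close>
  obtain z gz where z: "primitive_L2 z gz" and zD: "AE x in lebesgue_on {0<..<l}. z x = D x"
    using DW unfolding W12_iff_primitive[OF l] primitive_L2_def by blast
  have zc: "continuous_on {0..l} z"
    using z unfolding primitive_L2_def by (blast intro: primitive_on_continuous)
  have z0: "z 0 = \<i> * \<rho>"
    using cont_rep_eq[OF l zc zD, of 0] D0 l by simp
  define w1 where "w1 x = z x * f x" for x
  obtain g2 where g2: "primitive_L2 w1 g2"
    using primitive_L2_mult[OF z g] unfolding w1_def by blast
  have w1D: "AE x in lebesgue_on {0<..<l}. w1 x = D x / (1 / f x)"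
    using zD by (rule AE_mp, intro AE_I2) (auto simp: w1_def f_nz)
  have wd2: "AE x in lebesgue_on {0<..<l}. weak_deriv l (\<lambda>s. D s / (1 / f s)) x = g2 x"
    by (rule weak_deriv_AE_eq[OF l _ _ w1D]) (use g2 in \<open>unfold primitive_L2_def, blast+\<close>)
  have g2_eq: "AE x in lebesgue_on {0<..<l}. g2 x = (\<i> * \<rho>)\<^sup>2 * q x * u1 x"
  proof (rule AE_mp[OF wd2], rule AE_mp[OF S], intro AE_I2 impI)
    fix x assume x: "x \<in> space (lebesgue_on {0<..<l})" and S: "Sop l f y x = \<rho>\<^sup>2 * y x"
      and wd: "weak_deriv l (\<lambda>s. D s / (1 / f s)) x = g2 x"
    have fx: "f x \<noteq> 0" using x by (simp add: f_nz)
    have "- (1 / f x * g2 x) = \<rho>\<^sup>2 * y x"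
      using S wd unfolding Sop_def Dop_def[of l "\<lambda>s. 1 / f s"] D_def by simp
    then have "- g2 x = f x * (\<rho>\<^sup>2 * y x)" using fx by (simp add: field_simps)
    then have "g2 x = - (f x * (\<rho>\<^sup>2 * y x))" by (metis minus_minus)
    then show "g2 x = (\<i> * \<rho>)\<^sup>2 * q x * u1 x"
      using fx by (simp add: u1_def power_mult_distrib) (simp add: power2_eq_square)
  qed
  have g1_eq: "AE x in lebesgue_on {0<..<l}. g1 x = p x * w1 x"
  proof (rule AE_mp[OF zD], rule AE_mp[OF Dg1], intro AE_I2 impI)
    fix x assume x: "x \<in> space (lebesgue_on {0<..<l})" and zD: "z x = D x"
      and wd: "weak_deriv l (\<lambda>s. y s / f s) x = g1 x"
    have fx: "f x \<noteq> 0" using x by (simp add: f_nz)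
    show "g1 x = p x * w1 x"
      using zD wd fx unfolding D_def Dop_def w1_def by (simp add: power2_eq_square)
  qed
  have u1c: "continuous_on {0..l} u1" and w1c: "continuous_on {0..l} w1"
    using g1 g2 unfolding primitive_L2_def by (blast intro: primitive_on_continuous)+
  have u1_eq: "u1 x = 1 + integral {0..x} (\<lambda>t. p t * w1 t)" if x: "x \<in> {0..l}" for x
    using primitive_onD(1)[of l u1 g1 x] g1 x integral_cong_AE_lebesgue_on[OF g1_eq, of x]
    unfolding primitive_L2_def by (simp add: u1_def y0 f_0)
  have w1_eq: "w1 x = \<i> * \<rho> + integral {0..x} (\<lambda>t. (\<i> * \<rho>)\<^sup>2 * q t * u1 t)" if x: "x \<in> {0..l}" for x
    using primitive_onD(1)[of l w1 g2 x] g2 x integral_cong_AE_lebesgue_on[OF g2_eq, of x]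
    unfolding primitive_L2_def by (simp add: w1_def z0 f_0)
  have int: "h integrable_on {0..x}" if "continuous_on {0..l} h" "x \<in> {0..l}" for h :: "real \<Rightarrow> complex" and x
    by (intro integrable_continuous_real continuous_on_subset[OF that(1)]) (use that(2) in auto)
  have "u1 x - u \<rho> x = 0" if x: "x \<in> {0..l}" for x
  \<comment> \<open>The spectral factor is absorbed into the second weight.\<close>
  proof (rule homogeneous_Volterra_zero(1)[of l p "\<lambda>t. (\<i> * \<rho>)\<^sup>2 * q t" _ "\<lambda>x. w1 x - w \<rho> x"])
    fix x assume x: "x \<in> {0..l}"
    show "u1 x - u \<rho> x = integral {0..x} (\<lambda>t. p t * (w1 t - w \<rho> t))"
      unfolding u1_eq[OF x] u_eq[OF x] right_diff_distrib
      by (subst Henstock_Kurzweil_Integration.integral_diff)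
         (auto intro!: int continuous_on_mult p_cont w1c w_cont x simp del: times_divide_eq_left)
    show "w1 x - w \<rho> x = integral {0..x} (\<lambda>t. (\<i> * \<rho>)\<^sup>2 * q t * (u1 t - u \<rho> t))"
      unfolding w1_eq[OF x] w_eq[OF x] right_diff_distrib
      by (subst Henstock_Kurzweil_Integration.integral_diff)
         (auto intro!: int continuous_on_mult continuous_on_const q_cont u1c u_cont x)
  qed (intro continuous_on_mult continuous_on_diff continuous_on_const p_cont q_cont u1c u_cont w1c w_cont x)+
  then have u1_u: "u \<rho> x = u1 x" if "x \<in> {0..l}" for x using that by simp
  have "y x = f x * u \<rho> x" if "x \<in> {0..l}" for x
    unfolding u1_u[OF that] u1_def using f_nz[OF that] by simp
  then show ?thesis using yout by auto
qed

lemma ef_eq: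
  assumes "x \<in> {0..l}"
  shows "ef l f \<rho> x = f x * Volterra_series p q (\<i> * \<rho>) x"
proof -
  have "ef l f \<rho> = (THE y. is_ef \<rho> y)"
    unfolding ef_def is_ef_def ..
  also have "\<dots> = (\<lambda>x. if x \<in> {0..l} then f x * u \<rho> x else 0)"
    by (rule the_equality[of "is_ef \<rho>", OF is_ef_series is_ef_unique])
  finally show ?thesis using assms by (simp add: u_def)
qed

end

section \<open>Comparison of power series\<close>

text \<open>Convergence at 1 already gives both formal power series a positive radius, and series
  with equal evaluations near 0 are equal.\<close>

lemma power_series_coeff_unique:
  fixes a b :: "nat \<Rightarrow> complex"
  assumes a: "\<And>z. (\<lambda>k. a k * z ^ k) sums E z" and b: "\<And>z. (\<lambda>k. b k * z ^ k) sums E z"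
  shows "a = b"
proof -
  have rad: "fps_conv_radius (Abs_fps c) > 0" if "\<And>z. (\<lambda>k. c k * z ^ k) sums E z" for c
  proof -
    have "ereal (norm (1 :: complex)) \<le> conv_radius c"
      using that[of 1] by (intro conv_radius_geI) (simp add: sums_iff)
    moreover have "0 < ereal (norm (1 :: complex))" by simp
    ultimately have "0 < conv_radius c" by (rule order_less_le_trans[rotated])
    then show ?thesis by (simp add: fps_conv_radius_def)
  qed
  have "Abs_fps a = Abs_fps b"
  proof (rule eval_fps_eqD[OF rad[OF a] rad[OF b]])
    have "eval_fps (Abs_fps a) z = eval_fps (Abs_fps b) z" for z
      using a[of z] b[of z] by (simp add: eval_fps_def sums_iff)
    then show "\<forall>\<^sub>F z in nhds 0. eval_fps (Abs_fps a) z = eval_fps (Abs_fps b) z" by simp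
  qed
  then show ?thesis by (metis fps_nth_Abs_fps ext)
qed

text \<open>Sum and integral may be exchanged because \<open>\<bar>t\<bar> \<le> x\<close> on the
  domain bounds the L1 norms of the terms by a multiple of the exponential series in
  \<open>norm z * x\<close>. The coefficients are the moments of \<open>h\<close> over the
  factorials.\<close>

lemma exponential_moment_sums:
  fixes h :: "real \<Rightarrow> complex"
  assumes h: "h absolutely_integrable_on {-x..x::real}" and x: "0 \<le> x"
  shows "(\<lambda>k. (LINT t|lebesgue_on {-x<..<x}. h t * of_real t ^ k) / fact k * z ^ k)
    sums (LINT t|lebesgue_on {-x<..<x}. h t * exp (z * of_real t))"
proof -
  let ?M = "lebesgue_on {-x<..<x}"
  let ?g = "\<lambda>k t. h t * ((z * of_real t) ^ k /\<^sub>R fact k)"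
  have hi: "integrable ?M h"
    using absolutely_integrable_imp_integrable[OF absolutely_integrable_on_Icc_iff_Ioo[THEN iffD1, OF h]] by simp
  have gi: "integrable ?M (?g k)" for k
  proof -
    have "(\<lambda>t. (z * of_real t) ^ k /\<^sub>R fact k * h t) absolutely_integrable_on {-x..x}"
      by (intro abs_int_mult_continuous h continuous_intros)
    then have "integrable ?M (\<lambda>t. (z * of_real t) ^ k /\<^sub>R fact k * h t)"
      using absolutely_integrable_imp_integrable[OF absolutely_integrable_on_Icc_iff_Ioo[THEN iffD1]] by simp
    then show ?thesis by (simp add: mult.commute)
  qed
  have "(\<lambda>k. integral\<^sup>L ?M (?g k)) sums (\<integral>t. (\<Sum>k. ?g k t) \<partial>?M)"
  proof (rule sums_integral[OF gi])
    show "AE t in ?M. summable (\<lambda>k. norm (?g k t))"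
    proof (rule AE_I2)
      fix t
      have "summable (\<lambda>k. norm (h t) * (inverse (fact k) * norm (z * of_real t) ^ k))"
        by (intro summable_mult summable_exp)
      then show "summable (\<lambda>k. norm (?g k t))" by (simp add: norm_mult norm_power field_simps)
    qed
    have bd: "(\<integral>t. norm (?g k t) \<partial>?M) \<le> (\<integral>t. norm (h t) \<partial>?M) * (inverse (fact k) * (norm z * x) ^ k)" for k
    proof -
      have "(\<integral>t. norm (?g k t) \<partial>?M) \<le> (\<integral>t. norm (h t) * (inverse (fact k) * (norm z * x) ^ k) \<partial>?M)"
      proof (rule integral_mono)
        show "integrable ?M (\<lambda>t. norm (?g k t))" by (rule integrable_norm[OF gi])
        show "integrable ?M (\<lambda>t. norm (h t) * (inverse (fact k) * (norm z * x) ^ k))"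
          by (rule integrable_mult_left[OF integrable_norm[OF hi]])
        fix t assume "t \<in> space ?M"
        then have "norm (z * of_real t) ^ k \<le> (norm z * x) ^ k"
          unfolding norm_mult norm_of_real by (intro power_mono mult_left_mono) auto
        then have "norm (h t) * (inverse (fact k) * norm (z * of_real t) ^ k) \<le> norm (h t) * (inverse (fact k) * (norm z * x) ^ k)"
          by (intro mult_left_mono) auto
        then show "norm (?g k t) \<le> norm (h t) * (inverse (fact k) * (norm z * x) ^ k)"
          unfolding norm_mult[of "h t"] norm_scaleR norm_power by simp
      qed
      then show ?thesis by simp
    qed
    have "summable (\<lambda>k. (\<integral>t. norm (h t) \<partial>?M) * (inverse (fact k) * (norm z * x) ^ k))"
      by (intro summable_mult summable_exp)
    then show "summable (\<lambda>k. \<integral>t. norm (?g k t) \<partial>?M)"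
      by (rule summable_comparison_test') (use bd in simp)
  qed
  moreover have "(\<Sum>k. ?g k t) = h t * exp (z * of_real t)" for t
    using sums_mult[OF exp_converges[of "z * of_real t"], of "h t"] by (simp add: sums_iff)
  moreover have "integral\<^sup>L ?M (?g k) = (LINT t|?M. h t * of_real t ^ k) / fact k * z ^ k" for k
  proof -
    have "?g k t = h t * of_real t ^ k * (z ^ k / fact k)" for t
      by (simp add: power_mult_distrib scaleR_conv_of_real field_simps)
    then have "integral\<^sup>L ?M (?g k) = (LINT t|?M. h t * of_real t ^ k) * (z ^ k / fact k)"
      by (simp only: integral_mult_left_zero)
    then show ?thesis by simp
  qed
  ultimately show ?thesis by simp
qed

theorem theorem21:
  fixes l :: real and f :: "real \<Rightarrow> complex" and K :: "real \<times> real \<Rightarrow> complex"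
  assumes "0 < l"
    and "f \<in> W12 l" and "continuous_on {0..l} f"
    and "\<forall>x\<in>{0..l}. f x \<noteq> 0" and "f 0 = 1"
    and "transmutation_kernel l f K"
  shows "\<forall>k::nat. \<forall>x\<in>{0..l}. Top K (\<lambda>t. of_real t ^ k) x = formal_power f k x"
proof (intro allI ballI)
  fix k x assume x: "x \<in> {0..l}"
  interpret nonvanishing_W12 l f
    using assms by unfold_locales auto
  have fp: "formal_power f k x = fact k * f x * Volterra_iterate p q k x" for k
    by (rule formal_power_eq_Volterra_iterate[OF f_cont f_nz x])
  show "Top K (\<lambda>t. of_real t ^ k) x = formal_power f k x"
  proof (cases "x = 0")
    case True
    \<comment> \<open>The kernel identity covers only x > 0. At 0 the integral runs over the empty
      set, and both sides are 1 for k = 0 and 0 otherwise.\<close>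
    have "lebesgue_on {- 0<..<0::real} = lebesgue_on {}" by simp
    then have "(LINT t|lebesgue_on {- 0<..<0}. K (0, t) * of_real t ^ k) = 0"
      by (simp add: integral_eq_zero_null_sets)
    then show ?thesis
      unfolding fp unfolding Top_def True by (cases k) (simp_all add: f_0)
  next
    case False
    then have x': "x \<in> {0<..l}" "0 \<le> x" using x by auto
    have K: "(\<lambda>t. K (x, t)) absolutely_integrable_on {-x..x}"
      using assms(6) x'(1) unfolding transmutation_kernel_def by (blast intro: L2_on_imp_abs_int)
    \<comment> \<open>The substitution makes \<open>\<i> * \<rho>\<close> equal to \<open>z\<close>,
      an arbitrary complex number, so that both expansions are power series in
      \<open>z\<close>.\<close>
    define E where "E z = ef l f (- \<i> * z) x" for z
    have "(\<lambda>k. Top K (\<lambda>t. of_real t ^ k) x / fact k * z ^ k) sums E z" for z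
    proof -
      have "E z = exp (z * of_real x) + (LINT t|lebesgue_on {-x<..<x}. K (x, t) * exp (z * of_real t))"
        using assms(6) x'(1) unfolding transmutation_kernel_def E_def by simp
      moreover have "(\<lambda>k. of_real x ^ k / fact k * z ^ k) sums exp (z * of_real x)"
        using exp_converges[of "z * of_real x"]
        by (simp add: power_mult_distrib scaleR_conv_of_real field_simps)
      ultimately show ?thesis
        using sums_add[OF _ exponential_moment_sums[OF K x'(2), of z]]
        by (simp add: Top_def add_divide_distrib distrib_right)
    qed
    moreover have "(\<lambda>k. f x * Volterra_iterate p q k x * z ^ k) sums E z" for z
    proof -
      have "(\<lambda>k. z ^ k * Volterra_iterate p q k x) sums Volterra_series p q z x"
        using Volterra_series_uniform_limit(2)[OF p_cont q_cont x] unfolding Volterra_series_def by (rule summable_sums)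
      from sums_mult[OF this, of "f x"] show ?thesis
        unfolding E_def ef_eq[OF x] by (simp add: mult_ac)
    qed
    ultimately have "(\<lambda>k. Top K (\<lambda>t. of_real t ^ k) x / fact k) = (\<lambda>k. f x * Volterra_iterate p q k x)"
      by (rule power_series_coeff_unique)
    then have "Top K (\<lambda>t. of_real t ^ k) x / fact k = f x * Volterra_iterate p q k x"
      by (rule fun_cong)
    then show ?thesis unfolding fp by (simp add: field_simps)
  qed
qed

end
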